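(* Suppose there is $\gamma\ge\tfrac12$ and a representative $\tilde\kappa_P$ in the equivalence class of Markov kernels for $P_{Y|X}$ such that for every $g\in\mathcal H_\ell$ the map $x\mapsto\int_{\mathcal Y}g(y)\,\tilde\kappa_P(x,dy)$ belongs to $\mathrm{range}(C_{XX}^{\gamma})$, and that the analogous condition holds for $Q_{Z|X}$ with a representative $\tilde\kappa_Q$. Let $\Delta=C_{Y|X}-C_{Z|X}$. Then the squared $\mathrm{CMMD}_2$ satisfies $$\mathrm{CMMD}_2^2(P_{Y|X},Q_{Z|X})=\mathrm{Tr}(\Delta^*\Delta\,C_{XX}^2).$$
   Context: $P$ and $Q$ are probability measures on a measurable space; $X$ takes values in a topological space $\mathcal X$ with its Borel $\sigma$-algebra and $Y,Z$ take values in a measurable space $(\mathcal Y,\mathfrak Y)$. $P_X,Q_X$ are the laws of $X$ under $P,Q$; they have full support and are mutually absolutely continuous. $P_{Y|X}$ is the conditional distribution of $Y$ given $X$ under $P$ and $Q_{Z|X}$ that of $Z$ given $X$ under $Q$; both admit regular versions, represented by equivalence classes (equality for almost every $x$) of Markov kernels $\mathcal X\times\mathfrak Y\to[0,1]$. For a fixed $\alpha\in[0,1]$, $R_X=\alpha P_X+(1-\alpha)Q_X$. $k:\mathcal X\times\mathcal X\to\mathbb R$ and $\ell:\mathcal Y\times\mathcal Y\to\mathbb R$ are measurable positive definite kernels with RKHSs $\mathcal H_k$ (separable) and $\mathcal H_\ell$; $k$ is continuous and bounded ($k(x,x)\le k_{\max}$ for all $x$). $C_{XX}=\mathbb E_{X\sim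 R_X}[k(\cdot,X)\otimes k(\cdot,X)]$ is the covariance operator of $R_X$ on $\mathcal H_k$, i.e. $\langle f,C_{XX}f'\rangle_{\mathcal H_k}=\mathbb E_{X\sim R_X}[f(X)f'(X)]$. The conditional mean operator $C_{Y|X}:\mathcal H_k\to\mathcal H_\ell$ is the adjoint of $C_{Y|X}^*:\mathcal H_\ell\to\mathcal H_k$, $(C_{Y|X}^*g)(x)=\int g(y)\,\tilde\kappa_P(x,dy)$; $C_{Z|X}$ is defined likewise from $\tilde\kappa_Q$. $k\otimes\ell$ is the tensor product kernel $(k\otimes\ell)((x,y),(x',y'))=k(x,x')\ell(y,y')$ on $\mathcal X\times\mathcal Y$, with RKHS $\mathcal H_{k\otimes\ell}\cong\mathcal H_k\otimes\mathcal H_\ell$. The joint mean embeddings are $\mu_{XY}=\mathbb E[k(\cdot,X)\otimes\ell(\cdot,Y)]$ with $(X,Y)\sim P_{Y|X}\otimes R_X$ and $\mu_{XZ}=\mathbb E[k(\cdot,X)\otimes\ell(\cdot,Z)]$ with $(X,Z)\sim Q_{Z|X}\otimes R_X$ (these expectations in $\mathcal H_{k\otimes\ell}$ are assumed to exist, e.g. because $\mathbb E\sqrt{k(X,X)\ell(Y,Y)}<\infty$ and similarly for $Z$), and $$\mathrm{CMMD}_2(P_{Y|X},Q_{Z|X})=\|\mu_{XY}-\mu_{XZ}\|_{\mathcal H_{k\otimes\ell}}.$$ *)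

theory Defs
  imports "HOL-Probability.Probability"
begin

section \<open>Reproducing kernel Hilbert spaces\<close>

definition pos_def_kernel :: "'a set \<Rightarrow> ('a \<Rightarrow> 'a \<Rightarrow> real) \<Rightarrow> bool" where
  "pos_def_kernel S k \<longleftrightarrow>
     (\<forall>x\<in>S. \<forall>y\<in>S. k x y = k y x) \<and>
     (\<forall>F c. finite F \<longrightarrow> F \<subseteq> S \<longrightarrow> (\<Sum>x\<in>F. \<Sum>y\<in>F. c x * c y * k x y) \<ge> 0)"

text \<open>The Hilbert space \<open>'h\<close> is the RKHS of the kernel \<open>k\<close> on the set \<open>S\<close>: its elements are
  functions on \<open>S\<close>, where \<open>val h x\<close> is the value of \<open>h\<close> at \<open>x\<close>.  An element of \<open>'h\<close> is determined
  by its values on \<open>S\<close>, the vector space operations are pointwise, \<open>k(\<cdot>,x)\<close> belongs to the space,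
  and the reproducing property holds.\<close>

definition rkhs :: "'a set \<Rightarrow> ('a \<Rightarrow> 'a \<Rightarrow> real) \<Rightarrow> ('h::{real_inner,banach} \<Rightarrow> 'a \<Rightarrow> real) \<Rightarrow> bool" where
  "rkhs S k val \<longleftrightarrow>
     (\<forall>x\<in>S. linear (\<lambda>h. val h x)) \<and>
     (\<forall>h h'. (\<forall>x\<in>S. val h x = val h' x) \<longrightarrow> h = h') \<and>
     (\<forall>x\<in>S. \<exists>v. (\<forall>y\<in>S. val v y = k y x) \<and> (\<forall>h. h \<bullet> v = val h x))"

text \<open>The element \<open>k(\<cdot>,x)\<close> of the RKHS.\<close>

definition kernel_section :: "('h::{real_inner,banach} \<Rightarrow> 'a \<Rightarrow> real) \<Rightarrow> 'a \<Rightarrow> 'h" where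
  "kernel_section val x = (THE v. \<forall>h. h \<bullet> v = val h x)"

definition tensor_kernel ::
    "('a \<Rightarrow> 'a \<Rightarrow> real) \<Rightarrow> ('b \<Rightarrow> 'b \<Rightarrow> real) \<Rightarrow> 'a \<times> 'b \<Rightarrow> 'a \<times> 'b \<Rightarrow> real" where
  "tensor_kernel k l = (\<lambda>(x, y) (x', y'). k x x' * l y y')"

lemma kernel_section_eqI: "(\<And>h. h \<bullet> v = val h x) \<Longrightarrow> kernel_section val x = v"
  unfolding kernel_section_def
  by (rule the_equality) (auto intro: iffD1[OF vector_eq_ldot])

lemma inner_kernel_section:
  assumes "rkhs S k val" "x \<in> S"
  shows "h \<bullet> kernel_section val x = val h x"
proof -
  obtain v where "\<forall>h. h \<bullet> v = val h x"
    using assms unfolding rkhs_def by blast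
  with kernel_section_eqI[of v val x] show ?thesis by simp
qed

lemma kernel_section_apply:
  assumes "rkhs S k val" "x \<in> S" "y \<in> S"
  shows "val (kernel_section val x) y = k y x"
proof -
  obtain v where v: "\<forall>y\<in>S. val v y = k y x" "\<forall>h. h \<bullet> v = val h x"
    using assms unfolding rkhs_def by blast
  with kernel_section_eqI[of v val x] assms(3) show ?thesis by simp
qed

section \<open>Expectations of Hilbert space valued functions\<close>

text \<open>Mean embeddings live in a Hilbert space that need not be separable, so the expectation of
  \<open>F\<close> is taken in the weak sense, \<open>\<langle>h, \<mu>\<rangle> = E \<langle>h, F\<rangle>\<close> for all \<open>h\<close>.  It exists whenever all
  \<open>\<langle>h, F\<rangle>\<close> are measurable and \<open>E \<parallel>F\<parallel>\<close> is finite, and it extends the Bochner expectation.\<close>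

definition has_weak_expectation ::
    "'a measure \<Rightarrow> ('a \<Rightarrow> 'h::{real_inner,banach}) \<Rightarrow> 'h \<Rightarrow> bool" where
  "has_weak_expectation M F \<mu> \<longleftrightarrow>
     (\<forall>h. integrable M (\<lambda>\<omega>. h \<bullet> F \<omega>) \<and> h \<bullet> \<mu> = (\<integral>\<omega>. h \<bullet> F \<omega> \<partial>M))"

definition weak_expectation :: "'a measure \<Rightarrow> ('a \<Rightarrow> 'h::{real_inner,banach}) \<Rightarrow> 'h" where
  "weak_expectation M F = (THE \<mu>. has_weak_expectation M F \<mu>)"

lemma weak_expectation_eqI: "has_weak_expectation M F \<mu> \<Longrightarrow> weak_expectation M F = \<mu>"
  unfolding weak_expectation_def has_weak_expectation_def
  by (rule the_equality) (auto intro: iffD1[OF vector_eq_ldot])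

lemma has_bochner_integral_imp_has_weak_expectation:
  assumes "has_bochner_integral M F \<mu>"
  shows "has_weak_expectation M F \<mu>"
  unfolding has_weak_expectation_def
proof (intro allI)
  fix h
  have "has_bochner_integral M (\<lambda>\<omega>. h \<bullet> F \<omega>) (h \<bullet> \<mu>)"
    using bounded_linear_inner_right assms by (rule has_bochner_integral_bounded_linear)
  then show "integrable M (\<lambda>\<omega>. h \<bullet> F \<omega>) \<and> h \<bullet> \<mu> = (\<integral>\<omega>. h \<bullet> F \<omega> \<partial>M)"
    by (simp add: has_bochner_integral_iff)
qed

section \<open>Operators on Hilbert spaces\<close>

definition orthonormal_basis :: "'h::{real_inner,banach} set \<Rightarrow> bool" where
  "orthonormal_basis E \<longleftrightarrow>
     pairwise orthogonal E \<and> (\<forall>e\<in>E. norm e = 1) \<and> closure (span E) = UNIV"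

definition hilbert_schmidt :: "('h::{real_inner,banach} \<Rightarrow> 'h) \<Rightarrow> bool" where
  "hilbert_schmidt A \<longleftrightarrow>
     bounded_linear A \<and> (\<exists>E. orthonormal_basis E \<and> (\<lambda>e. (norm (A e))\<^sup>2) summable_on E)"

definition trace_class :: "('h::{real_inner,banach} \<Rightarrow> 'h) \<Rightarrow> bool" where
  "trace_class A \<longleftrightarrow> (\<exists>S T. hilbert_schmidt S \<and> hilbert_schmidt T \<and> A = S \<circ> T)"

text \<open>Meaningful for trace class operators, where the value does not depend on the basis.\<close>

definition op_trace :: "('h::{real_inner,banach} \<Rightarrow> 'h) \<Rightarrow> real" where
  "op_trace A = (\<Sum>\<^sub>\<infinity>e\<in>(SOME E. orthonormal_basis E). A e \<bullet> e)"

text \<open>The power \<open>A\<^sup>\<gamma>\<close> for \<open>\<gamma> > 0\<close> of a compact positive self-adjoint operator, such as the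
  covariance operator below, by spectral calculus: if \<open>E\<close> is an orthonormal basis of
  eigenvectors, the eigenvalue of \<open>e \<in> E\<close> is \<open>A e \<bullet> e\<close>, and
  \<open>A\<^sup>\<gamma> f = \<Sum>\<^sub>e (A e \<bullet> e)\<^sup>\<gamma> \<langle>f, e\<rangle> e\<close>.  The result does not depend on the choice of \<open>E\<close>.\<close>

definition op_powr :: "('h::{real_inner,banach} \<Rightarrow> 'h) \<Rightarrow> real \<Rightarrow> 'h \<Rightarrow> 'h" where
  "op_powr A \<gamma> f =
     (let E = (SOME E. orthonormal_basis E \<and> (\<forall>e\<in>E. \<exists>c. A e = c *\<^sub>R e))
      in \<Sum>\<^sub>\<infinity>e\<in>E. ((A e \<bullet> e) powr \<gamma> * (f \<bullet> e)) *\<^sub>R e)"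

section \<open>Laws, Markov kernels, conditional distributions\<close>

definition full_support :: "'a::topological_space measure \<Rightarrow> bool" where
  "full_support M \<longleftrightarrow> (\<forall>U. open U \<longrightarrow> U \<noteq> {} \<longrightarrow> emeasure M U > 0)"

text \<open>The measure \<open>\<alpha> M + (1 - \<alpha>) N\<close>.\<close>

definition mixture :: "real \<Rightarrow> 'a measure \<Rightarrow> 'a measure \<Rightarrow> 'a measure" where
  "mixture \<alpha> M N = measure_of (space M) (sets M)
     (\<lambda>A. ennreal \<alpha> * emeasure M A + ennreal (1 - \<alpha>) * emeasure N A)"

definition markov_kernel :: "'a measure \<Rightarrow> 'b measure \<Rightarrow> ('a \<Rightarrow> 'b measure) \<Rightarrow> bool" where
  "markov_kernel MX MY \<kappa> \<longleftrightarrow> \<kappa> \<in> measurable MX (prob_algebra MY)"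

text \<open>\<open>\<kappa>\<close> is a regular version of the conditional distribution of \<open>Y\<close> given \<open>X\<close> under \<open>P\<close>.\<close>

definition regular_cond_distr ::
    "'o measure \<Rightarrow> 'a measure \<Rightarrow> 'b measure \<Rightarrow> ('o \<Rightarrow> 'a) \<Rightarrow> ('o \<Rightarrow> 'b) \<Rightarrow> ('a \<Rightarrow> 'b measure) \<Rightarrow> bool" where
  "regular_cond_distr P MX MY X Y \<kappa> \<longleftrightarrow> markov_kernel MX MY \<kappa> \<and>
     (\<forall>A\<in>sets MX. \<forall>B\<in>sets MY. emeasure P {\<omega>\<in>space P. X \<omega> \<in> A \<and> Y \<omega> \<in> B} =
        (\<integral>\<^sup>+x\<in>A. emeasure (\<kappa> x) B \<partial>distr P MX X))"

text \<open>The law \<open>\<kappa> \<otimes> R\<close> of \<open>(X, Y)\<close> when \<open>X\<close> has law \<open>R\<close> and \<open>Y\<close> given \<open>X = x\<close> has law \<open>\<kappa> x\<close>.\<close>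

definition joint_law :: "'a measure \<Rightarrow> 'b measure \<Rightarrow> ('a \<Rightarrow> 'b measure) \<Rightarrow> ('a \<times> 'b) measure" where
  "joint_law R MY \<kappa> = R \<bind> (\<lambda>x. \<kappa> x \<bind> (\<lambda>y. return (R \<Otimes>\<^sub>M MY) (x, y)))"

lemma space_mixture [simp]: "space (mixture \<alpha> M N) = space M"
  and sets_mixture [simp]: "sets (mixture \<alpha> M N) = sets M"
  by (simp_all add: mixture_def)

lemma emeasure_mixture:
  assumes "sets M = sets N" "A \<in> sets M"
  shows "emeasure (mixture \<alpha> M N) A = ennreal \<alpha> * emeasure M A + ennreal (1 - \<alpha>) * emeasure N A"
proof (rule emeasure_measure_of[OF mixture_def])
  show "sets M \<subseteq> Pow (space M)" by (rule sets.space_closed)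
  show "A \<in> sets (mixture \<alpha> M N)" using assms by simp
  show "positive (sets (mixture \<alpha> M N))
     (\<lambda>A. ennreal \<alpha> * emeasure M A + ennreal (1 - \<alpha>) * emeasure N A)"
    by (simp add: positive_def)
  show "countably_additive (sets (mixture \<alpha> M N))
     (\<lambda>A. ennreal \<alpha> * emeasure M A + ennreal (1 - \<alpha>) * emeasure N A)"
  proof (rule countably_additiveI)
    fix F :: "nat \<Rightarrow> 'a set"
    assume F: "range F \<subseteq> sets (mixture \<alpha> M N)" "disjoint_family F"
    then have "(\<Sum>i. emeasure M (F i)) = emeasure M (\<Union>i. F i)"
      and "(\<Sum>i. emeasure N (F i)) = emeasure N (\<Union>i. F i)"
      using assms(1) by (auto intro!: suminf_emeasure)
    then show "(\<Sum>i. ennreal \<alpha> * emeasure M (F i) + ennreal (1 - \<alpha>) * emeasure N (F i)) =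
       ennreal \<alpha> * emeasure M (\<Union>i. F i) + ennreal (1 - \<alpha>) * emeasure N (\<Union>i. F i)"
      by (simp add: suminf_add[symmetric])
  qed
qed

section \<open>Covariance and conditional mean operators, CMMD\<close>

text \<open>\<open>E[k(\<cdot>,X) \<otimes> k(\<cdot>,X)]\<close> with \<open>X \<sim> R\<close>, where \<open>(k(\<cdot>,x) \<otimes> k(\<cdot>,x)) f = f(x) k(\<cdot>,x)\<close>.\<close>

definition covariance_op ::
    "'a measure \<Rightarrow> ('h::{real_inner,banach,second_countable_topology} \<Rightarrow> 'a \<Rightarrow> real) \<Rightarrow> 'h \<Rightarrow> 'h" where
  "covariance_op R val f = (\<integral>x. val f x *\<^sub>R kernel_section val x \<partial>R)"

text \<open>\<open>C\<^sub>Y\<^sub>|\<^sub>X\<^sup>*\<close> sends \<open>g\<close> to the element \<open>x \<mapsto> \<integral> g(y) \<kappa>(x,dy)\<close> of \<open>H\<^sub>k\<close>.\<close>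

definition cond_mean_op_adj ::
    "('hk::{real_inner,banach} \<Rightarrow> 'a \<Rightarrow> real) \<Rightarrow> ('hl::{real_inner,banach} \<Rightarrow> 'b \<Rightarrow> real) \<Rightarrow>
     ('a \<Rightarrow> 'b measure) \<Rightarrow> 'hl \<Rightarrow> 'hk" where
  "cond_mean_op_adj evk evl \<kappa> g = (THE h. \<forall>x. evk h x = (\<integral>y. evl g y \<partial>\<kappa> x))"

definition cond_mean_op ::
    "('hk::{real_inner,banach} \<Rightarrow> 'a \<Rightarrow> real) \<Rightarrow> ('hl::{real_inner,banach} \<Rightarrow> 'b \<Rightarrow> real) \<Rightarrow>
     ('a \<Rightarrow> 'b measure) \<Rightarrow> 'hk \<Rightarrow> 'hl" where
  "cond_mean_op evk evl \<kappa> = adjoint (cond_mean_op_adj evk evl \<kappa>)"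

text \<open>Here \<open>val\<close> is the RKHS of \<open>k \<otimes> \<ell>\<close>; its kernel section at \<open>(x, y)\<close> is \<open>k(\<cdot>,x) \<otimes> \<ell>(\<cdot>,y)\<close>.\<close>

definition joint_mean_embedding ::
    "('h::{real_inner,banach} \<Rightarrow> 'a \<times> 'b \<Rightarrow> real) \<Rightarrow> 'a measure \<Rightarrow> 'b measure \<Rightarrow>
     ('a \<Rightarrow> 'b measure) \<Rightarrow> 'h" where
  "joint_mean_embedding val R MY \<kappa> = weak_expectation (joint_law R MY \<kappa>) (kernel_section val)"

definition joint_mean_embedding_exists ::
    "('h::{real_inner,banach} \<Rightarrow> 'a \<times> 'b \<Rightarrow> real) \<Rightarrow> 'a measure \<Rightarrow> 'b measure \<Rightarrow>
     ('a \<Rightarrow> 'b measure) \<Rightarrow> bool" where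
  "joint_mean_embedding_exists val R MY \<kappa> \<longleftrightarrow>
     (\<exists>\<mu>. has_weak_expectation (joint_law R MY \<kappa>) (kernel_section val) \<mu>)"

definition CMMD2 ::
    "('h::{real_inner,banach} \<Rightarrow> 'a \<times> 'b \<Rightarrow> real) \<Rightarrow> 'a measure \<Rightarrow> 'b measure \<Rightarrow>
     ('a \<Rightarrow> 'b measure) \<Rightarrow> ('a \<Rightarrow> 'b measure) \<Rightarrow> real" where
  "CMMD2 val R MY \<kappa> \<kappa>' =
     norm (joint_mean_embedding val R MY \<kappa> - joint_mean_embedding val R MY \<kappa>')"

lemma inner_covariance_op:
  fixes val :: "'h::{real_inner,banach,second_countable_topology} \<Rightarrow> 'a::topological_space \<Rightarrow> real"
  assumes H: "rkhs UNIV k val"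
    and cont: "continuous_on UNIV (\<lambda>(x, x'). k x x')"
    and bdd: "\<And>x. k x x \<le> kmax"
    and R: "finite_measure R" "sets R = sets borel"
  shows "f \<bullet> covariance_op R val f' = (\<integral>x. val f x * val f' x \<partial>R)"
proof -
  let ?\<phi> = "kernel_section val"
  have inner: "h \<bullet> ?\<phi> x = val h x" for h x
    using inner_kernel_section[OF H] by simp
  have k: "?\<phi> x \<bullet> ?\<phi> y = k y x" for x y
    using inner kernel_section_apply[OF H] by simp
  have k_sym: "k x y = k y x" for x y
    using k[of x y] k[of y x] by (simp add: inner_commute)
  have cont\<phi>: "continuous_on UNIV ?\<phi>"
    unfolding continuous_on_def
  proof
    fix x
    have "continuous_on UNIV (\<lambda>y. k y y)"
      using continuous_on_compose2[OF cont continuous_on_Pair[OF continuous_on_id continuous_on_id]]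
      by simp
    then have 1: "((\<lambda>y. k y y) \<longlongrightarrow> k x x) (at x)"
      by (auto simp: continuous_on_def)
    have "continuous_on UNIV (\<lambda>y. k x y)"
      using continuous_on_compose2[OF cont continuous_on_Pair[OF continuous_on_const continuous_on_id]]
      by simp
    then have 2: "((\<lambda>y. k x y) \<longlongrightarrow> k x x) (at x)"
      by (auto simp: continuous_on_def)
    have "((\<lambda>y. k y y - 2 * k x y + k x x) \<longlongrightarrow> k x x - 2 * k x x + k x x) (at x)"
      by (intro tendsto_intros 1 2)
    moreover have "k y y - 2 * k x y + k x x = (norm (?\<phi> y - ?\<phi> x))\<^sup>2" for y
      by (simp add: power2_norm_eq_inner inner_diff_left inner_diff_right k)
        (simp add: k_sym)
    ultimately have "((\<lambda>y. (norm (?\<phi> y - ?\<phi> x))\<^sup>2) \<longlongrightarrow> 0) (at x)"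
      by simp
    from tendsto_real_sqrt[OF this] have "((\<lambda>y. norm (?\<phi> y - ?\<phi> x)) \<longlongrightarrow> 0) (at x)"
      by simp
    then show "(?\<phi> \<longlongrightarrow> ?\<phi> x) (at x)"
      by (rule LIM_zero_cancel[OF tendsto_norm_zero_cancel])
  qed
  have norm\<phi>: "norm (?\<phi> x) \<le> sqrt kmax" for x
    using bdd[of x] k[of x x] by (simp add: norm_eq_sqrt_inner)
  have "?\<phi> \<in> borel_measurable R"
    using borel_measurable_continuous_onI[OF cont\<phi>]
    by (simp add: measurable_cong_sets[OF R(2) refl])
  then have meas: "(\<lambda>x. val f' x *\<^sub>R ?\<phi> x) \<in> borel_measurable R"
    by (simp add: inner[symmetric])
  have "norm (val f' x *\<^sub>R ?\<phi> x) \<le> (norm f' * sqrt kmax) * sqrt kmax" for x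
  proof -
    have "\<bar>val f' x\<bar> \<le> norm f' * norm (?\<phi> x)"
      using Cauchy_Schwarz_ineq2[of f' "?\<phi> x"] by (simp only: inner)
    also have "\<dots> \<le> norm f' * sqrt kmax"
      by (rule mult_left_mono[OF norm\<phi> norm_ge_zero])
    finally have "\<bar>val f' x\<bar> * norm (?\<phi> x) \<le> (norm f' * sqrt kmax) * sqrt kmax"
      by (rule mult_mono'[OF _ norm\<phi> abs_ge_zero norm_ge_zero])
    then show ?thesis by simp
  qed
  then have "integrable R (\<lambda>x. val f' x *\<^sub>R ?\<phi> x)"
    by (intro finite_measure.integrable_const_bound[OF R(1) _ meas] AE_I2)
  then have "f \<bullet> covariance_op R val f' = (\<integral>x. f \<bullet> (val f' x *\<^sub>R ?\<phi> x) \<partial>R)"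
    unfolding covariance_op_def by (intro integral_inner_right[symmetric])
  then show ?thesis
    by (simp add: inner mult.commute)
qed

end

(*
Write \<phi> x for the kernel section k(.,x), B = \<Delta>^* for the difference of the two adjoint conditional
mean operators, C for the covariance operator and D = \<mu>_XY - \<mu>_XZ.  Evaluating D at a point gives
D(x,y) = <\<phi> x, C B l(.,y)> = (\<Delta> C \<phi> x)(y).  Integrating this function once more against the two
joint laws gives |D|^2 = <D, \<mu>_XY> - <D, \<mu>_XZ> = E <B \<Delta> C \<phi> X, \<phi> X>, so that neither the tensor
product structure of the RKHS of k \<otimes> l nor the Hilbert-Schmidt norm enters.  Expanding the inner
product in an orthonormal basis and integrating termwise turns E <S \<phi> X, \<phi> X> into Tr(S C) for every
bounded S; here S = \<Delta>^* \<Delta> C.  The conditional mean operators are bounded by the Baire category theorem,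
applied to lower semicontinuous seminorms, and C is Hilbert-Schmidt, so the operator is trace class.
*)
theory Submission
  imports Defs
begin

section \<open>Hilbert space\<close>

text \<open>The closed sublevel sets cover a complete space, so by Baire one of them contains a
  ball. Subadditivity moves this ball to the origin and homogeneity turns it into a global
  bound.\<close>

lemma lower_semicontinuous_seminorm_bounded:
  fixes p :: "'h::banach \<Rightarrow> real"
  assumes add: "\<And>x y. p (x + y) \<le> p x + p y"
    and scale: "\<And>c x. p (c *\<^sub>R x) = \<bar>c\<bar> * p x"
    and closed: "\<And>n::nat. closed {x. p x \<le> real n}"
  obtains B where "\<And>x. p x \<le> B * norm x"
proof -
  define G where "G = range (\<lambda>n::nat. {x. p x \<le> real n})"
  have "\<Union>G = UNIV"
    unfolding G_def by (auto intro: real_arch_simple)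
  moreover have "Met_TC.mcomplete TYPE('h)"
    by (simp add: complete_UNIV)
  ultimately obtain T where "T \<in> G" "interior T \<noteq> {}"
    using Met_TC.metric_Baire_category_alt[of G] closed
    by (fastforce simp: G_def)
  then obtain n z where "z \<in> interior {x. p x \<le> real n}"
    by (auto simp: G_def)
  then obtain r where r: "r > 0" "cball z r \<subseteq> {x. p x \<le> real n}"
    by (auto simp: mem_interior_cball)
  \<comment> \<open>Since \<open>y = (z + y) - z\<close> and both \<open>z + y\<close> and
    \<open>z\<close> lie in the ball, each contributes \<open>real n\<close>.\<close>
  have ball: "p y \<le> 2 * real n" if "norm y \<le> r" for y
  proof -
    have "z + y \<in> cball z r" "z \<in> cball z r"
      using that r(1) by (auto simp: dist_norm)
    then have "p (z + y) \<le> real n" "p z \<le> real n"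
      using r(2) by blast+
    moreover have "p y \<le> p (z + y) + p ((-1) *\<^sub>R z)"
      using add[of "z + y" "(-1) *\<^sub>R z"] by simp
    ultimately show ?thesis
      using scale[of "-1" z] by simp
  qed
  have "p x \<le> (2 * real n / r) * norm x" for x
  proof (cases "x = 0")
    case True
    then show ?thesis using scale[of 0 0] by simp
  next
    case False
    have "p x = p ((norm x / r) *\<^sub>R ((r / norm x) *\<^sub>R x))"
      using False r(1) by simp
    also have "\<dots> = (norm x / r) * p ((r / norm x) *\<^sub>R x)"
      using r(1) by (subst scale) simp
    also have "\<dots> \<le> (norm x / r) * (2 * real n)"
      using r(1) False by (intro mult_left_mono ball) auto
    finally show ?thesis by (simp add: mult.commute)
  qed
  then show ?thesis by (rule that)
qed

section \<open>Orthogonal projection, Riesz representation and adjoints\<close>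

text \<open>A sequence in \<open>S\<close> that minimises the distance to \<open>x\<close> is Cauchy
  by the parallelogram law. Its limit is a nearest point, and comparing it with its perturbations
  along \<open>S\<close> gives orthogonality.\<close>

lemma orthogonal_projection_exists:
  fixes S :: "'h::{real_inner,banach} set"
  assumes S: "subspace S" "closed S"
  obtains p where "p \<in> S" "\<And>s. s \<in> S \<Longrightarrow> (x - p) \<bullet> s = 0"
proof -
  define d where "d = infdist x S"
  have S0: "S \<noteq> {}" using subspace_0[OF S(1)] by auto
  have d_le: "d \<le> norm (x - s)" if "s \<in> S" for s
    using infdist_le[OF that, of x] by (simp add: d_def dist_norm)
  have d_nonneg: "0 \<le> d" by (simp add: d_def infdist_nonneg)
  have "\<exists>s\<in>S. norm (x - s) < d + 1 / real (Suc n)" for n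
  proof -
    have "infdist x S < d + 1 / real (Suc n)" by (simp add: d_def)
    then show ?thesis
      using S0 by (simp add: infdist_notempty cINF_less_iff flip: dist_norm)
  qed
  then obtain s where s: "\<And>n. s n \<in> S" "\<And>n. norm (x - s n) < d + 1 / real (Suc n)"
    by metis
  have lim: "(\<lambda>n. norm (x - s n)) \<longlonglongrightarrow> d"
  proof (rule real_tendsto_sandwich)
    show "\<forall>\<^sub>F n in sequentially. d \<le> norm (x - s n)" using d_le s(1) by auto
    show "\<forall>\<^sub>F n in sequentially. norm (x - s n) \<le> d + 1 / real (Suc n)"
      by (intro always_eventually allI less_imp_le s(2))
    show "(\<lambda>n. d + 1 / real (Suc n)) \<longlonglongrightarrow> d"
      using tendsto_add[OF tendsto_const LIMSEQ_inverse_real_of_nat, of d]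
      by (simp add: inverse_eq_divide)
  qed auto
  \<comment> \<open>The midpoint of \<open>s m\<close> and \<open>s n\<close> lies in
    \<open>S\<close>, hence at distance at least \<open>d\<close> from \<open>x\<close>; the
    parallelogram law converts this into a bound on \<open>s m - s n\<close>.\<close>
  have par: "(norm (s m - s n))\<^sup>2 \<le> 2 * (norm (x - s m))\<^sup>2 + 2 * (norm (x - s n))\<^sup>2 - 4 * d\<^sup>2" for m n
  proof -
    have "(1/2) *\<^sub>R (s m + s n) \<in> S"
      using S(1) s(1) by (intro subspace_scale subspace_add)
    then have "d \<le> norm (x - (1/2) *\<^sub>R (s m + s n))" by (rule d_le)
    then have "d\<^sup>2 \<le> (norm (x - (1/2) *\<^sub>R (s m + s n)))\<^sup>2"
      using d_nonneg by (rule power_mono)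
    moreover have "(x - s m) + (x - s n) = 2 *\<^sub>R (x - (1/2) *\<^sub>R (s m + s n))"
      by (simp add: algebra_simps scaleR_2)
    then have "norm ((x - s m) + (x - s n)) = 2 * norm (x - (1/2) *\<^sub>R (s m + s n))"
      by simp
    moreover have "(norm (a - b))\<^sup>2 + (norm (a + b))\<^sup>2 = 2 * (norm a)\<^sup>2 + 2 * (norm b)\<^sup>2" for a b :: 'h
      by (simp add: power2_norm_eq_inner inner_diff inner_add inner_commute)
    from this[of "x - s n" "x - s m"]
    have "(norm (s m - s n))\<^sup>2 + (norm ((x - s m) + (x - s n)))\<^sup>2
        = 2 * (norm (x - s m))\<^sup>2 + 2 * (norm (x - s n))\<^sup>2"
      by (simp add: add.commute)
    ultimately show ?thesis by (simp add: power_mult_distrib)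
  qed
  have "Cauchy s"
  proof (rule metric_CauchyI)
    fix e :: real assume "e > 0"
    \<comment> \<open>The bound in \<open>par\<close> is the mean of this expression at
      \<open>m\<close> and at \<open>n\<close>, so it is below the square of \<open>e\<close> as
      soon as both values are.\<close>
    have "(\<lambda>n. 4 * (norm (x - s n))\<^sup>2 - 4 * d\<^sup>2) \<longlonglongrightarrow> 4 * d\<^sup>2 - 4 * d\<^sup>2"
      by (intro tendsto_intros lim)
    then have "\<forall>\<^sub>F n in sequentially. 4 * (norm (x - s n))\<^sup>2 - 4 * d\<^sup>2 < e\<^sup>2"
      using \<open>e > 0\<close> by (intro order_tendstoD(2)) auto
    then obtain N where N: "\<And>n. n \<ge> N \<Longrightarrow> 4 * (norm (x - s n))\<^sup>2 - 4 * d\<^sup>2 < e\<^sup>2"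
      by (auto simp: eventually_sequentially)
    have "dist (s m) (s n) < e" if "m \<ge> N" "n \<ge> N" for m n
    proof -
      have "(norm (s m - s n))\<^sup>2 < e\<^sup>2" using par[of m n] N[OF that(1)] N[OF that(2)] by simp
      then show ?thesis using \<open>e > 0\<close> by (simp add: dist_norm power_less_imp_less_base)
    qed
    then show "\<exists>M. \<forall>m\<ge>M. \<forall>n\<ge>M. dist (s m) (s n) < e" by blast
  qed
  then obtain p where p: "s \<longlonglongrightarrow> p"
    using Cauchy_convergent convergent_def by blast
  have "p \<in> S"
    using S(2) s(1) p closed_sequentially by blast
  have norm_p: "norm (x - p) = d"
    by (rule LIMSEQ_unique[OF _ lim]) (intro tendsto_intros p)
  have "(x - p) \<bullet> v = 0" if "v \<in> S" for v
  proof (rule ccontr)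
    let ?a = "(x - p) \<bullet> v"
    assume a: "?a \<noteq> 0"
    then have v: "v \<bullet> v > 0" by auto
    \<comment> \<open>This \<open>t\<close> minimises the distance from \<open>x\<close> to
      \<open>p + t *\<^sub>R v\<close>; for nonzero \<open>?a\<close> the distance would drop
      strictly below \<open>d\<close>.\<close>
    define t where "t = ?a / (v \<bullet> v)"
    have "p + t *\<^sub>R v \<in> S"
      using S(1) \<open>p \<in> S\<close> that by (intro subspace_add subspace_scale)
    then have "d \<le> norm (x - (p + t *\<^sub>R v))" by (rule d_le)
    then have "(norm (x - p))\<^sup>2 \<le> (norm ((x - p) - t *\<^sub>R v))\<^sup>2"
      using d_nonneg norm_p by (intro power_mono) (auto simp: algebra_simps)
    also have "\<dots> = (norm (x - p))\<^sup>2 - 2 * t * ?a + t * t * (v \<bullet> v)"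
      unfolding power2_norm_eq_inner by (simp add: inner_diff inner_commute)
    also have "t * t * (v \<bullet> v) = t * ?a"
      using v by (simp add: t_def)
    finally have "t * ?a \<le> 0" by simp
    moreover have "t * ?a > 0"
      using a v by (auto simp: t_def zero_less_divide_iff zero_less_mult_iff not_less)
    ultimately show False by simp
  qed
  with \<open>p \<in> S\<close> show ?thesis by (rule that)
qed

text \<open>The null space of a nonzero \<open>f\<close> is closed. A vector \<open>z\<close>
  orthogonal to it with nonzero \<open>f z\<close> spans its complement, so a multiple of
  \<open>z\<close> represents \<open>f\<close>.\<close>

lemma riesz_representation:
  fixes f :: "'h::{real_inner,banach} \<Rightarrow> real"
  assumes "bounded_linear f"
  obtains v where "\<And>x. f x = x \<bullet> v"
proof -
  interpret bounded_linear f by fact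
  show thesis
  proof (cases "\<forall>x. f x = 0")
    case True
    then show thesis by (intro that[of 0]) simp
  next
    case False
    then obtain x where x: "f x \<noteq> 0" by blast
    have "subspace {x. f x = 0}"
      by (auto simp: subspace_def add scaleR zero)
    moreover have "closed {x. f x = 0}"
      by (intro closed_Collect_eq continuous_on continuous_intros)
    ultimately obtain p where p: "f p = 0" "\<And>s. f s = 0 \<Longrightarrow> (x - p) \<bullet> s = 0"
      by (rule orthogonal_projection_exists[of _ x]) auto
    define z where "z = x - p"
    have fz: "f z \<noteq> 0" using x p(1) by (simp add: z_def diff)
    then have z: "z \<bullet> z \<noteq> 0" using zero by auto
    have "f y = y \<bullet> ((f z / (z \<bullet> z)) *\<^sub>R z)" for y
    proof -
      have "f (y - (f y / f z) *\<^sub>R z) = 0" using fz by (simp add: diff scaleR)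
      then have "z \<bullet> (y - (f y / f z) *\<^sub>R z) = 0" unfolding z_def by (rule p(2))
      then have "y \<bullet> z = (f y / f z) * (z \<bullet> z)" by (simp add: inner_diff_right inner_commute)
      then show ?thesis using z fz by simp
    qed
    then show thesis by (rule that)
  qed
qed

text \<open>\<open>adjoint\<close> is defined by choice and has its defining property only if some
  adjoint exists; Riesz representation of each functional \<open>A x \<bullet> y\<close> provides
  one.\<close>

lemma inner_adjoint:
  fixes A :: "'h::{real_inner,banach} \<Rightarrow> 'g::real_inner"
  assumes "bounded_linear A"
  shows "A x \<bullet> y = x \<bullet> adjoint A y"
proof -
  have "\<exists>v. \<forall>x. A x \<bullet> y = x \<bullet> v" for y
  proof -
    have "bounded_linear (\<lambda>x. A x \<bullet> y)"
      using assms by (rule bounded_linear_compose[OF bounded_linear_inner_left])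
    from riesz_representation[OF this] show ?thesis by metis
  qed
  then obtain g where g: "\<forall>x y. A x \<bullet> y = x \<bullet> g y" by metis
  then show ?thesis using adjoint_unique[OF g] by simp
qed

lemma bounded_linear_adjoint:
  fixes A :: "'h::{real_inner,banach} \<Rightarrow> 'g::real_inner"
  assumes "bounded_linear A"
  shows "bounded_linear (adjoint A)"
proof -
  note adj = inner_adjoint[OF assms]
  obtain K where K: "K \<ge> 0" "\<And>x. norm (A x) \<le> norm x * K"
    using bounded_linear.nonneg_bounded[OF assms] by blast
  show ?thesis
  proof (rule bounded_linear_intro)
    show "adjoint A (x + y) = adjoint A x + adjoint A y" for x y
      by (rule vector_eq_ldot[THEN iffD1]) (simp add: adj[symmetric] inner_add_right)
    show "adjoint A (c *\<^sub>R x) = c *\<^sub>R adjoint A x" for c x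
      by (rule vector_eq_ldot[THEN iffD1]) (simp add: adj[symmetric])
    show "norm (adjoint A y) \<le> norm y * K" for y
    proof -
      let ?w = "adjoint A y"
      have "norm ?w * norm ?w = A ?w \<bullet> y"
        by (simp add: adj power2_norm_eq_inner[symmetric] power2_eq_square)
      also have "\<dots> \<le> norm (A ?w) * norm y" by (rule norm_cauchy_schwarz)
      also have "\<dots> \<le> (norm ?w * K) * norm y" by (intro mult_right_mono K) simp
      finally have "norm ?w * norm ?w \<le> norm ?w * (norm y * K)" by (simp add: ac_simps)
      then show ?thesis
        using K(1) by (cases "?w = 0") auto
    qed
  qed
qed

section \<open>Orthonormal bases and Fourier expansions\<close>

lemma subspace_closure:
  fixes S :: "'a::real_normed_vector set"
  assumes "subspace S"
  shows "subspace (closure S)"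
proof (rule subspaceI)
  show "0 \<in> closure S"
    using subspace_0[OF assms] closure_subset by blast
next
  fix x y assume "x \<in> closure S" "y \<in> closure S"
  then obtain a b where "\<And>n. a n \<in> S" "a \<longlonglongrightarrow> x" "\<And>n. b n \<in> S" "b \<longlonglongrightarrow> y"
    unfolding closure_sequential by blast
  then show "x + y \<in> closure S"
    unfolding closure_sequential
    by (intro exI[of _ "\<lambda>n. a n + b n"]) (auto intro: subspace_add[OF assms] tendsto_add)
next
  fix c x assume "x \<in> closure S"
  then obtain a where "\<And>n. a n \<in> S" "a \<longlonglongrightarrow> x"
    unfolding closure_sequential by blast
  then show "c *\<^sub>R x \<in> closure S"
    unfolding closure_sequential
    by (intro exI[of _ "\<lambda>n. c *\<^sub>R a n"]) (auto intro: subspace_scale[OF assms] tendsto_scaleR)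
qed

text \<open>The residual of projecting \<open>x\<close> onto the closed span is orthogonal to
  \<open>S\<close>, hence zero.\<close>

lemma dense_span_if_orthogonal_trivial:
  fixes S :: "'h::{real_inner,banach} set"
  assumes "\<And>z. (\<And>s. s \<in> S \<Longrightarrow> z \<bullet> s = 0) \<Longrightarrow> z = 0"
  shows "closure (span S) = UNIV"
proof -
  have "x \<in> closure (span S)" for x
  proof -
    obtain p where p: "p \<in> closure (span S)" "\<And>s. s \<in> closure (span S) \<Longrightarrow> (x - p) \<bullet> s = 0"
      using orthogonal_projection_exists[of "closure (span S)" x] subspace_closure[OF subspace_span, of S]
      by auto
    have "(x - p) \<bullet> s = 0" if "s \<in> S" for s
      using that closure_subset[of "span S"] by (intro p(2)) (auto intro: span_base)
    then have "x - p = 0" by (rule assms)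
    then show ?thesis using p(1) by simp
  qed
  then show ?thesis by auto
qed

text \<open>Zorn's lemma gives a maximal orthonormal set. A nonzero vector orthogonal to it could be
  normalised and added, so its span is dense. The choice of a basis in \<open>op_trace\<close> rests
  on this.\<close>

lemma orthonormal_basis_exists: "\<exists>E :: 'h::{real_inner,banach} set. orthonormal_basis E"
proof -
  define \<A> where "\<A> = {E :: 'h set. pairwise orthogonal E \<and> (\<forall>e\<in>E. norm e = 1)}"
  have "\<exists>E\<in>\<A>. \<forall>F\<in>\<A>. E \<subseteq> F \<longrightarrow> F = E"
  proof (rule Zorn_Lemma, rule ballI)
    fix C assume C: "C \<in> chains \<A>"
    then have "pairwise orthogonal (\<Union>C)"
      by (intro pairwise_chain_Union) (auto simp: chains_def \<A>_def)
    moreover have "\<forall>e\<in>\<Union>C. norm e = 1"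
      using C by (auto simp: chains_def \<A>_def)
    ultimately show "\<Union>C \<in> \<A>" by (simp add: \<A>_def)
  qed
  then obtain E where E: "E \<in> \<A>" and max: "\<And>F. F \<in> \<A> \<Longrightarrow> E \<subseteq> F \<Longrightarrow> F = E" by blast
  have "z = 0" if z: "\<And>e. e \<in> E \<Longrightarrow> z \<bullet> e = 0" for z
  proof (rule ccontr)
    assume "z \<noteq> 0"
    define u where "u = sgn z"
    have u: "norm u = 1" "\<And>e. e \<in> E \<Longrightarrow> u \<bullet> e = 0"
      using \<open>z \<noteq> 0\<close> z by (simp_all add: u_def sgn_div_norm)
    then have "insert u E \<in> \<A>"
      using E by (auto simp: \<A>_def pairwise_insert orthogonal_def inner_commute)
    then have "u \<in> E" using max[of "insert u E"] by auto
    then have "u \<bullet> u = 0" by (rule u(2))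
    then show False using u(1) by auto
  qed
  then have "closure (span E) = UNIV" by (rule dense_span_if_orthogonal_trivial)
  with E show ?thesis by (auto simp: orthonormal_basis_def \<A>_def)
qed

text \<open>Distinct basis vectors are at distance at least 1 (in fact the square root of 2), so
  balls of radius 1/2 around them are disjoint open sets, of which a second countable space has only
  countably many.\<close>

lemma orthonormal_basis_countable:
  fixes E :: "'h::{real_inner,banach,second_countable_topology} set"
  assumes "orthonormal_basis E"
  shows "countable E"
proof -
  have dist: "dist e f \<ge> 1" if "e \<in> E" "f \<in> E" "e \<noteq> f" for e f
  proof -
    have "e \<bullet> f = 0" "norm e = 1" "norm f = 1"
      using assms that by (auto simp: orthonormal_basis_def pairwise_def orthogonal_def)
    then have "(norm (e - f))\<^sup>2 = 2"
      by (simp add: power2_norm_eq_inner inner_diff inner_commute) (simp add: norm_eq_1)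
    then have "1\<^sup>2 \<le> (norm (e - f))\<^sup>2" by simp
    then have "1 \<le> norm (e - f)" by (rule power2_le_imp_le) simp
    then show ?thesis by (simp add: dist_norm)
  qed
  have disj: "ball e (1/2) \<inter> ball f (1/2) = {}" if "e \<in> E" "f \<in> E" "e \<noteq> f" for e f
    using dist[OF that] by (intro disjoint_ballI) simp
  have "countable ((\<lambda>e. ball e (1/2)) ` E)"
  proof (rule countable_disjoint_open_subsets)
    show "pairwise disjnt ((\<lambda>e. ball e (1/2)) ` E)"
      by (intro pairwise_imageI) (simp add: disj disjnt_def)
  qed auto
  moreover have "inj_on (\<lambda>e. ball e (1/2 :: real)) E"
  proof (rule inj_onI, rule ccontr)
    fix e f assume ef: "e \<in> E" "f \<in> E" "ball e (1/2 :: real) = ball f (1/2)" "e \<noteq> f"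
    from disj[OF ef(1,2,4)] have "ball f (1/2) = {}"
      unfolding ef(3) Int_absorb .
    then show False by simp
  qed
  ultimately show ?thesis by (rule countable_image_inj_on)
qed

context
  fixes E :: "'h::{real_inner,banach} set"
  assumes E: "orthonormal_basis E"
begin

lemma orthonormal_basis_inner: "e \<in> E \<Longrightarrow> f \<in> E \<Longrightarrow> e \<bullet> f = (if e = f then 1 else 0)"
  using E by (auto simp: orthonormal_basis_def pairwise_def orthogonal_def norm_eq_1)

text \<open>The residual of the Fourier sum is orthogonal to the span of \<open>F\<close>, which
  contains the difference of the sum and \<open>s\<close>. Pythagoras then gives best
  approximation.\<close>

lemma norm_diff_fourier_sum_le:
  assumes F: "finite F" "F \<subseteq> E" and s: "s \<in> span F"
  shows "norm (x - (\<Sum>e\<in>F. (x \<bullet> e) *\<^sub>R e)) \<le> norm (x - s)"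
proof -
  let ?q = "\<Sum>e\<in>F. (x \<bullet> e) *\<^sub>R e"
  have perp: "(x - ?q) \<bullet> f = 0" if "f \<in> F" for f
  proof -
    have "?q \<bullet> f = (\<Sum>e\<in>F. if e = f then x \<bullet> e else 0)"
      unfolding inner_sum_left
    proof (intro sum.cong refl)
      fix e assume "e \<in> F"
      then show "(x \<bullet> e) *\<^sub>R e \<bullet> f = (if e = f then x \<bullet> e else 0)"
        using orthonormal_basis_inner[of e f] subsetD[OF F(2)] that by auto
    qed
    then show ?thesis using F(1) that by (simp add: inner_diff_left)
  qed
  have "?q - s \<in> span F"
    by (rule span_diff[OF _ s]) (intro span_sum span_scale span_base)
  then have "orthogonal (x - ?q) (?q - s)"
    by (rule orthogonal_to_span) (simp only: orthogonal_def perp)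
  then have "(norm ((x - ?q) + (?q - s)))\<^sup>2 = (norm (x - ?q))\<^sup>2 + (norm (?q - s))\<^sup>2"
    by (rule norm_add_Pythagorean)
  then have "(norm (x - ?q))\<^sup>2 \<le> (norm (x - s))\<^sup>2" by simp
  then show ?thesis by (rule power2_le_imp_le) simp
qed

text \<open>A vector of \<open>span E\<close> close to \<open>x\<close> involves only a finite set
  \<open>F\<close> of basis vectors. By best approximation every finite partial sum whose index set
  contains \<open>F\<close> is at least as close, which is unordered convergence.\<close>

lemma has_sum_fourier: "((\<lambda>e. (x \<bullet> e) *\<^sub>R e) has_sum x) E"
  unfolding has_sum_def tendsto_iff eventually_finite_subsets_at_top
proof (intro allI impI)
  fix \<epsilon> :: real assume "\<epsilon> > 0"
  have "x \<in> closure (span E)" using E by (simp add: orthonormal_basis_def)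
  then obtain s where s: "s \<in> span E" "dist s x < \<epsilon>"
    using \<open>\<epsilon> > 0\<close> by (auto simp: closure_approachable)
  obtain F where F: "finite F" "F \<subseteq> E" "s \<in> span F"
  proof -
    obtain F r where "finite F" "F \<subseteq> E" "s = (\<Sum>a\<in>F. r a *\<^sub>R a)"
      using s(1) by (auto simp: span_explicit)
    then show thesis
      by (intro that[of F]) (auto intro!: span_sum span_scale intro: span_base)
  qed
  show "\<exists>X. finite X \<and> X \<subseteq> E \<and> (\<forall>Y. finite Y \<and> X \<subseteq> Y \<and> Y \<subseteq> E \<longrightarrow> dist (\<Sum>e\<in>Y. (x \<bullet> e) *\<^sub>R e) x < \<epsilon>)"
  proof (intro exI[of _ F] conjI allI impI F(1,2))
    fix Y assume Y: "finite Y \<and> F \<subseteq> Y \<and> Y \<subseteq> E"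
    then have "s \<in> span Y" using F(3) span_mono by blast
    then have "norm (x - (\<Sum>e\<in>Y. (x \<bullet> e) *\<^sub>R e)) \<le> norm (x - s)"
      using Y by (intro norm_diff_fourier_sum_le) auto
    then show "dist (\<Sum>e\<in>Y. (x \<bullet> e) *\<^sub>R e) x < \<epsilon>"
      using s(2) by (simp add: dist_norm norm_minus_commute)
  qed
qed

lemma has_sum_parseval: "((\<lambda>e. (x \<bullet> e) * (y \<bullet> e)) has_sum (x \<bullet> y)) E"
  using has_sum_bounded_linear[OF bounded_linear_inner_left has_sum_fourier, of y x]
  by (simp add: inner_commute mult.commute)

lemma bessel:
  assumes "F \<subseteq> E" "finite F"
  shows "(\<Sum>e\<in>F. (x \<bullet> e)\<^sup>2) \<le> (norm x)\<^sup>2"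
proof -
  have "((\<lambda>e. (x \<bullet> e)\<^sup>2) has_sum (norm x)\<^sup>2) E"
    using has_sum_parseval[of x x] by (simp add: power2_eq_square power2_norm_eq_inner[unfolded power2_eq_square])
  then show ?thesis
    using assms finite_sum_le_has_sum by (metis (no_types, lifting) zero_le_power2)
qed

end

section \<open>The covariance operator\<close>

locale bounded_continuous_rkhs = prob_space R
  for R :: "'x::topological_space measure" +
  fixes k :: "'x \<Rightarrow> 'x \<Rightarrow> real"
    and evk :: "'h::{real_inner,banach,second_countable_topology} \<Rightarrow> 'x \<Rightarrow> real"
    and kmax :: real
  assumes rkhs_k: "rkhs UNIV k evk"
    and k_cont: "continuous_on UNIV (\<lambda>(x, x'). k x x')"
    and k_bdd: "\<And>x. k x x \<le> kmax"
    and sets_R: "sets R = sets borel"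
begin

abbreviation \<phi> :: "'x \<Rightarrow> 'h" where "\<phi> \<equiv> kernel_section evk"
abbreviation C :: "'h \<Rightarrow> 'h" where "C \<equiv> covariance_op R evk"

lemma inner_\<phi>: "h \<bullet> \<phi> x = evk h x"
  using inner_kernel_section[OF rkhs_k] by simp

lemma evk_diff: "evk (f - g) x = evk f x - evk g x"
  by (simp add: inner_\<phi>[symmetric] inner_diff_left)

lemma evk_scaleR: "evk (c *\<^sub>R h) x = c * evk h x"
  by (simp add: inner_\<phi>[symmetric])

lemma \<phi>_inner_\<phi>: "\<phi> x \<bullet> \<phi> y = k y x"
  using kernel_section_apply[OF rkhs_k] by (simp add: inner_\<phi>)

text \<open>Expanding the squared distance of two sections leaves only kernel values, and these
  cancel in the limit. Measurability of \<open>\<phi>\<close> follows from this.\<close>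

lemma continuous_\<phi>: "continuous_on UNIV \<phi>"
  unfolding continuous_on_def
proof
  fix x
  have k1: "((\<lambda>y. k (f y) (g y)) \<longlongrightarrow> k (f x) (g x)) (at x)"
    if "continuous_on UNIV f" "continuous_on UNIV g" for f g :: "'x \<Rightarrow> 'x"
  proof -
    have "continuous_on UNIV (\<lambda>y. k (f y) (g y))"
      using continuous_on_compose2[OF k_cont continuous_on_Pair[OF that]] by simp
    then show ?thesis by (auto simp: continuous_on_def)
  qed
  have "((\<lambda>y. k y y - k x y - k y x + k x x) \<longlongrightarrow> k x x - k x x - k x x + k x x) (at x)"
    using k1[of "\<lambda>y. y" "\<lambda>y. y"] k1[of "\<lambda>y. x" "\<lambda>y. y"] k1[of "\<lambda>y. y" "\<lambda>y. x"]
    by (intro tendsto_intros) auto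
  moreover have "k y y - k x y - k y x + k x x = (norm (\<phi> y - \<phi> x))\<^sup>2" for y
    by (simp add: power2_norm_eq_inner inner_diff_left inner_diff_right \<phi>_inner_\<phi>)
  ultimately have "((\<lambda>y. (norm (\<phi> y - \<phi> x))\<^sup>2) \<longlongrightarrow> 0) (at x)" by simp
  from tendsto_real_sqrt[OF this] have "((\<lambda>y. norm (\<phi> y - \<phi> x)) \<longlongrightarrow> 0) (at x)" by simp
  then show "(\<phi> \<longlongrightarrow> \<phi> x) (at x)"
    by (rule LIM_zero_cancel[OF tendsto_norm_zero_cancel])
qed

lemma measurable_\<phi> [measurable]: "\<phi> \<in> borel_measurable R"
  using borel_measurable_continuous_onI[OF continuous_\<phi>]
  by (simp add: measurable_cong_sets[OF sets_R refl])

lemma measurable_evk [measurable]: "evk h \<in> borel_measurable R"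
proof -
  have "(\<lambda>x. h \<bullet> \<phi> x) \<in> borel_measurable R" by measurable
  then show ?thesis by (simp add: inner_\<phi>)
qed

lemma norm_\<phi>_sq_le: "(norm (\<phi> x))\<^sup>2 \<le> kmax"
  using k_bdd[of x] by (simp add: power2_norm_eq_inner \<phi>_inner_\<phi>)

lemma kmax_nonneg: "0 \<le> kmax"
  using norm_\<phi>_sq_le zero_le_power2 by (rule order_trans[rotated])

lemma evk_sq_le: "(evk h x)\<^sup>2 \<le> (norm h)\<^sup>2 * kmax"
proof -
  have "(evk h x)\<^sup>2 \<le> (norm h)\<^sup>2 * (norm (\<phi> x))\<^sup>2"
    using Cauchy_Schwarz_ineq[of h "\<phi> x"] by (simp add: inner_\<phi> power2_norm_eq_inner)
  also have "\<dots> \<le> (norm h)\<^sup>2 * kmax" by (intro mult_left_mono norm_\<phi>_sq_le) simp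
  finally show ?thesis .
qed

lemma integrable_evk_mult: "integrable R (\<lambda>x. evk f x * evk g x)"
proof (rule integrable_const_bound)
  have "\<bar>evk f x * evk g x\<bar> \<le> ((norm f)\<^sup>2 * kmax + (norm g)\<^sup>2 * kmax) / 2" for x
  proof -
    have "2 * \<bar>evk f x * evk g x\<bar> \<le> (evk f x)\<^sup>2 + (evk g x)\<^sup>2"
      using sum_squares_bound[of "\<bar>evk f x\<bar>" "\<bar>evk g x\<bar>"] by (simp add: abs_mult)
    then show ?thesis using evk_sq_le[of f x] evk_sq_le[of g x] by simp
  qed
  then show "AE x in R. norm (evk f x * evk g x) \<le> ((norm f)\<^sup>2 * kmax + (norm g)\<^sup>2 * kmax) / 2"
    by simp
qed measurable

lemma inner_C: "f \<bullet> C g = (\<integral>x. evk f x * evk g x \<partial>R)"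
  using inner_covariance_op[OF rkhs_k k_cont k_bdd _ sets_R] finite_measure_axioms by blast

lemma inner_C_commute: "f \<bullet> C g = C f \<bullet> g"
  by (simp add: inner_C inner_commute[of "C f"] mult.commute)

text \<open>Integrating \<open>2ab \<le> a^2 / kmax + kmax * b^2\<close> with \<open>a\<close> the
  value of \<open>C f\<close> and \<open>b\<close> that of \<open>f\<close> bounds twice the left
  side; the first term is absorbed. Both boundedness and the Hilbert-Schmidt property of
  \<open>C\<close> come from this estimate.\<close>

lemma norm_C_sq_le: "(norm (C f))\<^sup>2 \<le> kmax * (\<integral>x. (evk f x)\<^sup>2 \<partial>R)"
proof -
  have int: "integrable R (\<lambda>x. (evk h x)\<^sup>2)" for h
    using integrable_evk_mult[of h h] by (simp add: power2_eq_square)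
  have Cf: "(norm (C f))\<^sup>2 = (\<integral>x. evk (C f) x * evk f x \<partial>R)"
    using inner_C[of "C f" f] by (simp add: power2_norm_eq_inner)
  show ?thesis
  \<comment> \<open>The weighted inequality divides by \<open>kmax\<close>; if \<open>kmax\<close>
    is zero, all functions in the space vanish.\<close>
  proof (cases "kmax = 0")
    case True
    have "evk h x = 0" for h x
      using evk_sq_le[of h x] True by simp
    then show ?thesis using Cf True by simp
  next
    case False
    then have kmax: "kmax > 0" using kmax_nonneg by simp
    have "2 * (norm (C f))\<^sup>2 = (\<integral>x. 2 * (evk (C f) x * evk f x) \<partial>R)"
      by (simp add: Cf)
    also have "\<dots> \<le> (\<integral>x. (evk (C f) x)\<^sup>2 / kmax + kmax * (evk f x)\<^sup>2 \<partial>R)"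
    proof (rule integral_mono)
      fix x
      have "0 \<le> (evk (C f) x - kmax * evk f x)\<^sup>2 / kmax"
        using kmax by simp
      also have "\<dots> = (evk (C f) x)\<^sup>2 / kmax - 2 * (evk (C f) x * evk f x) + kmax * (evk f x)\<^sup>2"
        using kmax by (simp add: power2_eq_square field_simps)
      finally show "2 * (evk (C f) x * evk f x) \<le> (evk (C f) x)\<^sup>2 / kmax + kmax * (evk f x)\<^sup>2"
        by simp
    qed (use int integrable_evk_mult in auto)
    also have "\<dots> = (\<integral>x. (evk (C f) x)\<^sup>2 / kmax \<partial>R) + (\<integral>x. kmax * (evk f x)\<^sup>2 \<partial>R)"
      using int by (intro Bochner_Integration.integral_add) auto
    also have "(\<integral>x. (evk (C f) x)\<^sup>2 / kmax \<partial>R) \<le> (\<integral>x. (norm (C f))\<^sup>2 \<partial>R)"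
    proof (rule integral_mono)
      show "(evk (C f) x)\<^sup>2 / kmax \<le> (norm (C f))\<^sup>2" for x
        using evk_sq_le[of "C f" x] kmax by (simp add: divide_le_eq)
    qed (use int in auto)
    finally show ?thesis by (simp add: prob_space)
  qed
qed

lemma bounded_linear_C: "bounded_linear C"
proof (rule bounded_linear_intro)
  show "C (f + g) = C f + C g" for f g
    by (rule vector_eq_ldot[THEN iffD1]) (simp add: inner_C_commute inner_add_right)
  show "C (c *\<^sub>R f) = c *\<^sub>R C f" for c f
    by (rule vector_eq_ldot[THEN iffD1]) (simp add: inner_C_commute)
  show "norm (C f) \<le> norm f * kmax" for f
  proof (rule power2_le_imp_le)
    have "(\<integral>x. (evk f x)\<^sup>2 \<partial>R) \<le> (\<integral>x. (norm f)\<^sup>2 * kmax \<partial>R)"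
      using integrable_evk_mult[of f f] evk_sq_le
      by (intro integral_mono) (auto simp: power2_eq_square)
    then have "kmax * (\<integral>x. (evk f x)\<^sup>2 \<partial>R) \<le> kmax * ((norm f)\<^sup>2 * kmax)"
      using kmax_nonneg by (intro mult_left_mono) (auto simp: prob_space)
    then show "(norm (C f))\<^sup>2 \<le> (norm f * kmax)\<^sup>2"
      using norm_C_sq_le[of f] by (simp add: power2_eq_square algebra_simps)
  qed (simp add: kmax_nonneg)
qed

section \<open>Hilbert-Schmidt property and trace formula for the covariance operator\<close>

text \<open>Summing \<open>norm_C_sq_le\<close> under the integral, Bessel's inequality bounds the
  squared values of the basis vectors at \<open>x\<close> by the squared norm of
  \<open>\<phi> x\<close>, hence by \<open>kmax\<close>.\<close>

lemma summable_norm_C_sq: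
  assumes E: "orthonormal_basis E"
  shows "(\<lambda>e. (norm (C e))\<^sup>2) summable_on E"
proof (rule nonneg_bdd_above_summable_on)
  have "(\<Sum>e\<in>F. (norm (C e))\<^sup>2) \<le> kmax * kmax" if F: "F \<subseteq> E" "finite F" for F
  proof -
    have int: "integrable R (\<lambda>x. (evk h x)\<^sup>2)" for h
      using integrable_evk_mult[of h h] by (simp add: power2_eq_square)
    have "(\<Sum>e\<in>F. (norm (C e))\<^sup>2) \<le> (\<Sum>e\<in>F. kmax * (\<integral>x. (evk e x)\<^sup>2 \<partial>R))"
      by (intro sum_mono norm_C_sq_le)
    also have "\<dots> = kmax * (\<integral>x. (\<Sum>e\<in>F. (evk e x)\<^sup>2) \<partial>R)"
      using int by (simp add: sum_distrib_left)
    also have "\<dots> \<le> kmax * (\<integral>x. kmax \<partial>R)"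
    proof (intro mult_left_mono integral_mono kmax_nonneg)
      fix x
      have "(\<Sum>e\<in>F. (evk e x)\<^sup>2) = (\<Sum>e\<in>F. (\<phi> x \<bullet> e)\<^sup>2)"
        by (simp add: inner_\<phi>[symmetric] inner_commute)
      also have "\<dots> \<le> (norm (\<phi> x))\<^sup>2" using E F by (rule bessel)
      finally show "(\<Sum>e\<in>F. (evk e x)\<^sup>2) \<le> kmax" using norm_\<phi>_sq_le[of x] by simp
    qed (use int in auto)
    finally show ?thesis by (simp add: prob_space)
  qed
  then show "bdd_above (sum (\<lambda>e. (norm (C e))\<^sup>2) ` {F. F \<subseteq> E \<and> finite F})"
    by (intro bdd_aboveI) auto
qed simp

lemma hilbert_schmidt_compose_C:
  assumes S: "bounded_linear (S :: 'h \<Rightarrow> 'h)"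
  shows "hilbert_schmidt (S \<circ> C)"
  unfolding hilbert_schmidt_def
proof
  show "bounded_linear (S \<circ> C)"
    unfolding o_def using S bounded_linear_C by (rule bounded_linear_compose)
  obtain K where K: "K \<ge> 0" "\<And>x. norm (S x) \<le> norm x * K"
    using bounded_linear.nonneg_bounded[OF S] by blast
  obtain E :: "'h set" where E: "orthonormal_basis E" using orthonormal_basis_exists by blast
  have "(\<lambda>e. K\<^sup>2 * (norm (C e))\<^sup>2) summable_on E"
    using summable_norm_C_sq[OF E] by (rule summable_on_cmult_right)
  then have "(\<lambda>e. (norm ((S \<circ> C) e))\<^sup>2) summable_on E"
  proof (rule summable_on_comparison_test)
    fix e
    have "(norm (S (C e)))\<^sup>2 \<le> (norm (C e) * K)\<^sup>2" by (intro power_mono K) simp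
    then show "(norm ((S \<circ> C) e))\<^sup>2 \<le> K\<^sup>2 * (norm (C e))\<^sup>2"
      by (simp add: power_mult_distrib mult.commute)
  qed simp
  with E show "\<exists>E. orthonormal_basis E \<and> (\<lambda>e. (norm ((S \<circ> C) e))\<^sup>2) summable_on E" by blast
qed

text \<open>Parseval expands the integrand, and Fubini for \<open>R\<close> and counting measure on
  \<open>E\<close> allows integration term by term. The basis is arbitrary, so the one chosen in
  \<open>op_trace\<close> is covered.\<close>

lemma trace_compose_C:
  assumes S: "bounded_linear (S :: 'h \<Rightarrow> 'h)" and E: "orthonormal_basis E"
  shows "(\<Sum>\<^sub>\<infinity>e\<in>E. S (C e) \<bullet> e) = (\<integral>x. S (\<phi> x) \<bullet> \<phi> x \<partial>R)"
proof -
  obtain K where K: "K \<ge> 0" "\<And>x. norm (S x) \<le> norm x * K"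
    using bounded_linear.nonneg_bounded[OF S] by blast
  define f where "f x e = (S (\<phi> x) \<bullet> e) * (\<phi> x \<bullet> e)" for x e
  note countable = orthonormal_basis_countable[OF E]
  \<comment> \<open>Countability of the basis, due to separability, makes the counting measure
    sigma-finite and the integrand jointly measurable.\<close>
  interpret E: sigma_finite_measure "count_space E"
    using countable by (rule sigma_finite_measure_count_space_countable)
  interpret RE: pair_sigma_finite R "count_space E" ..
  have S\<phi> [measurable]: "(\<lambda>x. S (\<phi> x)) \<in> borel_measurable R"
    using measurable_compose[OF measurable_\<phi> borel_measurable_continuous_onI[OF linear_continuous_on[OF S]]]
    by simp
  have "(\<lambda>(e, x). f x e) \<in> borel_measurable (count_space E \<Otimes>\<^sub>M R)"
    by (rule measurable_pair_measure_countable1[OF countable]) (simp add: f_def)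
  then have f_meas [measurable]: "case_prod f \<in> borel_measurable (R \<Otimes>\<^sub>M count_space E)"
    by (subst measurable_pair_swap_iff) simp
  have has_sum: "((\<lambda>e. f x e) has_sum (S (\<phi> x) \<bullet> \<phi> x)) E" for x
    unfolding f_def using E by (rule has_sum_parseval)
  \<comment> \<open>For real families unordered and absolute summability agree; the passage to
    \<open>infsetsum\<close>, which is an integral over \<open>count_space E\<close>, makes Fubini
    applicable.\<close>
  have abs: "Infinite_Set_Sum.abs_summable_on (f x) E" for x
    using has_sum[of x] has_sum_imp_summable summable_on_iff_abs_summable_on_real abs_summable_equivalent
    by blast
  have sum: "(\<integral>e. f x e \<partial>count_space E) = S (\<phi> x) \<bullet> \<phi> x" for x
    using infsumI[OF has_sum[of x]] infsetsum_infsum[OF abs[of x]] by (simp add: infsetsum_def)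
  \<comment> \<open>The product is dominated by the sum of the squared coefficients of
    \<open>S (\<phi> x)\<close> and \<open>\<phi> x\<close>, whose sums Parseval evaluates. The
    bound is uniform in \<open>x\<close>, hence integrable.\<close>
  have sum_abs: "(\<integral>e. norm (f x e) \<partial>count_space E) \<le> kmax * (K\<^sup>2 + 1)" for x
  proof -
    have sq: "((\<lambda>e. (h \<bullet> e)\<^sup>2) has_sum (norm h)\<^sup>2) E" for h
      using has_sum_parseval[OF E, of h h] by (simp add: power2_eq_square power2_norm_eq_inner[unfolded power2_eq_square])
    have "(\<integral>e. norm (f x e) \<partial>count_space E) = (\<Sum>\<^sub>\<infinity>e\<in>E. norm (f x e))"
      using infsetsum_infsum[OF abs_summable_on_normI[OF abs[of x]]] by (simp add: infsetsum_def)
    also have "\<dots> \<le> (norm (S (\<phi> x)))\<^sup>2 + (norm (\<phi> x))\<^sup>2"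
    proof (rule has_sum_mono)
      show "((\<lambda>e. norm (f x e)) has_sum (\<Sum>\<^sub>\<infinity>e\<in>E. norm (f x e))) E"
        using abs[of x] by (intro has_sum_infsum) (simp flip: abs_summable_equivalent)
      show "((\<lambda>e. (S (\<phi> x) \<bullet> e)\<^sup>2 + (\<phi> x \<bullet> e)\<^sup>2) has_sum ((norm (S (\<phi> x)))\<^sup>2 + (norm (\<phi> x))\<^sup>2)) E"
        by (intro has_sum_add sq)
      fix e
      have "0 \<le> \<bar>S (\<phi> x) \<bullet> e\<bar> * \<bar>\<phi> x \<bullet> e\<bar>" by simp
      then show "norm (f x e) \<le> (S (\<phi> x) \<bullet> e)\<^sup>2 + (\<phi> x \<bullet> e)\<^sup>2"
        using sum_squares_bound[of "\<bar>S (\<phi> x) \<bullet> e\<bar>" "\<bar>\<phi> x \<bullet> e\<bar>"]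
        unfolding f_def real_norm_def abs_mult power2_abs by linarith
    qed
    also have "\<dots> \<le> (norm (\<phi> x) * K)\<^sup>2 + (norm (\<phi> x))\<^sup>2"
      by (intro add_mono power_mono K) auto
    also have "\<dots> = (norm (\<phi> x))\<^sup>2 * (K\<^sup>2 + 1)" by (simp add: algebra_simps)
    also have "\<dots> \<le> kmax * (K\<^sup>2 + 1)" by (intro mult_right_mono norm_\<phi>_sq_le) auto
    finally show ?thesis .
  qed
  have integrable_f: "integrable (R \<Otimes>\<^sub>M count_space E) (case_prod f)"
  proof (rule RE.Fubini_integrable)
    show "integrable R (\<lambda>x. \<integral>e. norm (case_prod f (x, e)) \<partial>count_space E)"
      using sum_abs by (intro integrable_const_bound[of _ "kmax * (K\<^sup>2 + 1)"]) auto
    show "AE x in R. integrable (count_space E) (\<lambda>e. case_prod f (x, e))"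
      using abs by (simp add: abs_summable_on_def)
  qed measurable
  \<comment> \<open>Moving \<open>S\<close> to the other side makes both factors point evaluations,
    so \<open>inner_C\<close> applies.\<close>
  have coeff: "(\<integral>x. f x e \<partial>R) = S (C e) \<bullet> e" for e
  proof -
    have "f x e = evk (adjoint S e) x * evk e x" for x
      using inner_adjoint[OF S, of "\<phi> x" e] inner_\<phi>[of "adjoint S e" x] inner_\<phi>[of e x]
      by (simp add: f_def inner_commute)
    then have "(\<integral>x. f x e \<partial>R) = adjoint S e \<bullet> C e" by (simp add: inner_C)
    then show ?thesis unfolding inner_adjoint[OF S] by (simp only: inner_commute[of "C e"])
  qed
  have "Infinite_Set_Sum.abs_summable_on (\<lambda>e. S (C e) \<bullet> e) E"
    using RE.integrable_snd[OF integrable_f] by (simp add: coeff abs_summable_on_def)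
  then have "(\<Sum>\<^sub>\<infinity>e\<in>E. S (C e) \<bullet> e) = (\<integral>e. \<integral>x. f x e \<partial>R \<partial>count_space E)"
    by (simp add: coeff infsetsum_def flip: infsetsum_infsum)
  also have "\<dots> = (\<integral>x. \<integral>e. f x e \<partial>count_space E \<partial>R)"
    using integrable_f by (rule RE.Fubini_integral)
  finally show ?thesis by (simp add: sum)
qed

end

section \<open>Conditional mean operators\<close>

text \<open>By Fatou's lemma the seminorm \<open>g \<mapsto> \<integral> \<bar>g\<bar>\<close> is lower semicontinuous.\<close>

lemma integral_functional_bounded:
  fixes evl :: "'h::{real_inner,banach} \<Rightarrow> 'y \<Rightarrow> real"
  assumes H: "rkhs (space M) l evl" and int: "\<And>g. integrable M (evl g)"
  shows "bounded_linear (\<lambda>g. \<integral>y. evl g y \<partial>M)"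
proof -
  have lin: "linear (\<lambda>g. evl g y)" if "y \<in> space M" for y
    using H that by (auto simp: rkhs_def)
  define p where "p g = (\<integral>y. \<bar>evl g y\<bar> \<partial>M)" for g
  \<comment> \<open>Sublevel sets are restated with the nonnegative integral, for which Fatou needs
    no dominating function.\<close>
  have p_le: "p g \<le> c \<longleftrightarrow> (\<integral>\<^sup>+y. ennreal \<bar>evl g y\<bar> \<partial>M) \<le> ennreal c" if "0 \<le> c" for g c
    using that int[of g] by (simp add: p_def nn_integral_eq_integral)
  obtain B where B: "\<And>g. p g \<le> B * norm g"
  proof (rule lower_semicontinuous_seminorm_bounded)
    show "p (f + g) \<le> p f + p g" for f g
    proof -
      have "p (f + g) \<le> (\<integral>y. \<bar>evl f y\<bar> + \<bar>evl g y\<bar> \<partial>M)"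
        unfolding p_def using int by (intro integral_mono) (auto simp: linear_add[OF lin])
      then show ?thesis using int by (simp add: p_def)
    qed
    show "p (c *\<^sub>R g) = \<bar>c\<bar> * p g" for c g
    proof -
      have "p (c *\<^sub>R g) = (\<integral>y. \<bar>c\<bar> * \<bar>evl g y\<bar> \<partial>M)"
        unfolding p_def by (intro Bochner_Integration.integral_cong) (auto simp: linear_scale[OF lin] abs_mult)
      then show ?thesis by (simp add: p_def)
    qed
    show "closed {g. p g \<le> real n}" for n
      unfolding closed_sequential_limits
    proof (intro allI impI, elim conjE)
      fix g h assume g: "\<forall>i. g i \<in> {g. p g \<le> real n}" and lim: "g \<longlonglongrightarrow> h"
      have "(\<lambda>i. evl (g i) y) \<longlonglongrightarrow> evl h y" if "y \<in> space M" for y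
      proof -
        have "(\<lambda>i. g i \<bullet> kernel_section evl y) \<longlonglongrightarrow> h \<bullet> kernel_section evl y"
          by (intro tendsto_intros lim)
        then show ?thesis by (simp add: inner_kernel_section[OF H that])
      qed
      then have pw: "liminf (\<lambda>i. ennreal \<bar>evl (g i) y\<bar>) = ennreal \<bar>evl h y\<bar>" if "y \<in> space M" for y
        using that by (intro lim_imp_Liminf tendsto_ennrealI tendsto_rabs) auto
      have "(\<integral>\<^sup>+y. ennreal \<bar>evl h y\<bar> \<partial>M) = (\<integral>\<^sup>+y. liminf (\<lambda>i. ennreal \<bar>evl (g i) y\<bar>) \<partial>M)"
        by (intro nn_integral_cong) (simp add: pw)
      also have "\<dots> \<le> liminf (\<lambda>i. \<integral>\<^sup>+y. ennreal \<bar>evl (g i) y\<bar> \<partial>M)"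
        using int by (intro nn_integral_liminf) auto
      also have "\<dots> \<le> liminf (\<lambda>i. ennreal (real n))"
        using g p_le by (intro Liminf_mono always_eventually) auto
      finally show "h \<in> {g. p g \<le> real n}"
        by (simp add: p_le Liminf_const)
    qed
  qed blast
  show ?thesis
  proof (rule bounded_linear_intro)
    show "(\<integral>y. evl (f + g) y \<partial>M) = (\<integral>y. evl f y \<partial>M) + (\<integral>y. evl g y \<partial>M)" for f g
    proof -
      have "(\<integral>y. evl (f + g) y \<partial>M) = (\<integral>y. evl f y + evl g y \<partial>M)"
        by (intro Bochner_Integration.integral_cong) (auto simp: linear_add[OF lin])
      then show ?thesis using int by simp
    qed
    show "(\<integral>y. evl (c *\<^sub>R g) y \<partial>M) = c *\<^sub>R (\<integral>y. evl g y \<partial>M)" for c g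
    proof -
      have "(\<integral>y. evl (c *\<^sub>R g) y \<partial>M) = (\<integral>y. c * evl g y \<partial>M)"
        by (intro Bochner_Integration.integral_cong) (auto simp: linear_scale[OF lin])
      then show ?thesis by simp
    qed
    show "norm (\<integral>y. evl g y \<partial>M) \<le> norm g * B" for g
      using order_trans[OF integral_norm_bound[of M "evl g"]] B[of g]
      by (simp add: p_def mult.commute[of _ B])
  qed
qed

text \<open>The norm of \<open>A g\<close> is a supremum of \<open>A g \<bullet> h\<close> over \<open>h\<close> in the span of the kernel sections, and
  each \<open>A g \<bullet> h\<close> is continuous in \<open>g\<close>.  Hence it is lower semicontinuous in \<open>g\<close>.\<close>

lemma bounded_linear_if_pointwise:
  fixes evk :: "'h::{real_inner,banach} \<Rightarrow> 'x \<Rightarrow> real"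
    and A :: "'g::banach \<Rightarrow> 'h"
  assumes H: "rkhs UNIV k evk"
    and pw: "\<And>x. bounded_linear (\<lambda>g. evk (A g) x)"
  shows "bounded_linear A"
proof -
  let ?\<phi> = "kernel_section evk"
  have ker: "h \<bullet> ?\<phi> x = evk h x" for h x
    using inner_kernel_section[OF H] by simp
  have lin: "evk (u + v) x = evk u x + evk v x" "evk (c *\<^sub>R u) x = c * evk u x" for u v c x
    by (simp_all add: ker[symmetric] inner_add_left)
  have eqI: "u = v" if "\<And>x. u \<bullet> ?\<phi> x = v \<bullet> ?\<phi> x" for u v
    using H that by (auto simp: rkhs_def ker)
  have add: "A (f + g) = A f + A g" for f g
    using bounded_linear.linear[OF pw, THEN linear_add] by (intro eqI) (simp add: ker lin)
  have scale: "A (c *\<^sub>R g) = c *\<^sub>R A g" for c g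
    using bounded_linear.linear[OF pw, THEN linear_scale] by (intro eqI) (simp add: ker lin)
  have dense: "closure (span (range ?\<phi>)) = UNIV"
  proof (rule dense_span_if_orthogonal_trivial)
    fix z assume "\<And>s. s \<in> range ?\<phi> \<Longrightarrow> z \<bullet> s = 0"
    then show "z = 0" by (intro eqI) auto
  qed
  have cont: "continuous_on UNIV (\<lambda>g. A g \<bullet> h)" if "h \<in> span (range ?\<phi>)" for h
    using that
  proof (induction rule: span_induct_alt)
    case base
    then show ?case by simp
  next
    case (step c w h)
    then obtain x where "w = ?\<phi> x" by auto
    then have "continuous_on UNIV (\<lambda>g. A g \<bullet> w)"
      using linear_continuous_on[OF pw[of x]] by (simp add: ker)
    then show ?case
      using step(2) unfolding inner_add_right inner_scaleR_right
      by (intro continuous_on_add continuous_on_mult_left)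
  qed
  have norm_le_iff: "norm u \<le> real n \<longleftrightarrow> (\<forall>h\<in>span (range ?\<phi>). u \<bullet> h \<le> real n * norm h)" for u n
  proof (intro iffI ballI)
    fix h assume "norm u \<le> real n"
    then show "u \<bullet> h \<le> real n * norm h"
      using norm_cauchy_schwarz[of u h] mult_right_mono[of "norm u" "real n" "norm h"] by simp
  next
    assume *: "\<forall>h\<in>span (range ?\<phi>). u \<bullet> h \<le> real n * norm h"
    have "closed {h. u \<bullet> h \<le> real n * norm h}"
      by (intro closed_Collect_le continuous_intros)
    then have "closure (span (range ?\<phi>)) \<subseteq> {h. u \<bullet> h \<le> real n * norm h}"
      using * by (intro closure_minimal) auto
    \<comment> \<open>The test vector \<open>h = u\<close> need not lie in the span, but it lies in
      its closure.\<close>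
    then have "u \<in> {h. u \<bullet> h \<le> real n * norm h}"
      unfolding dense by blast
    then have "norm u * norm u \<le> real n * norm u"
      by (auto simp: power2_norm_eq_inner[symmetric] power2_eq_square)
    then show "norm u \<le> real n" by (cases "u = 0") auto
  qed
  obtain B where "\<And>g. norm (A g) \<le> B * norm g"
  proof (rule lower_semicontinuous_seminorm_bounded)
    show "norm (A (f + g)) \<le> norm (A f) + norm (A g)" for f g
      by (simp add: add norm_triangle_ineq)
    show "norm (A (c *\<^sub>R g)) = \<bar>c\<bar> * norm (A g)" for c g
      by (simp add: scale)
    \<comment> \<open>By \<open>norm_le_iff\<close> the set is an intersection of sets closed by the
      continuity of each \<open>A g \<bullet> h\<close>.\<close>
    show "closed {g. norm (A g) \<le> real n}" for n
      unfolding norm_le_iff Collect_ball_eq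
      by (intro closed_INT ballI closed_Collect_le cont continuous_on_const)
  qed blast
  then show ?thesis
    by (intro bounded_linear_intro[of A B] add scale) (simp add: mult.commute)
qed

section \<open>Joint laws and their mean embeddings\<close>

lemma measurable_joint_law_kernel:
  assumes \<kappa>: "\<kappa> \<in> measurable R (prob_algebra MY)"
  shows "(\<lambda>x. \<kappa> x \<bind> (\<lambda>y. return (R \<Otimes>\<^sub>M MY) (x, y))) \<in> measurable R (subprob_algebra (R \<Otimes>\<^sub>M MY))"
proof (rule measurable_bind)
  show "\<kappa> \<in> measurable R (subprob_algebra MY)" using \<kappa> by (rule measurable_prob_algebraD)
qed simp

lemma sets_joint_law:
  assumes "prob_space R" and "\<kappa> \<in> measurable R (prob_algebra MY)"
  shows "sets (joint_law R MY \<kappa>) = sets (R \<Otimes>\<^sub>M MY)"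
  unfolding joint_law_def
proof (rule sets_bind)
  show "space R \<noteq> {}" using assms(1) by (rule prob_space.not_empty)
  show "sets (\<kappa> x \<bind> (\<lambda>y. return (R \<Otimes>\<^sub>M MY) (x, y))) = sets (R \<Otimes>\<^sub>M MY)" if "x \<in> space R" for x
    using measurable_space[OF measurable_joint_law_kernel[OF assms(2)] that]
    by (simp add: space_subprob_algebra)
qed

text \<open>This transfers the joint law from a given version of the conditional distribution to the
  representative that satisfies the range condition.\<close>

lemma joint_law_cong_AE:
  assumes "\<kappa> \<in> measurable R (prob_algebra MY)" "\<kappa>' \<in> measurable R (prob_algebra MY)"
    and "AE x in R. \<kappa> x = \<kappa>' x"
  shows "joint_law R MY \<kappa> = joint_law R MY \<kappa>'"
  unfolding joint_law_def
proof (rule bind_cong_AE[OF refl measurable_joint_law_kernel measurable_joint_law_kernel])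
  show "AE x in R. \<kappa> x \<bind> (\<lambda>y. return (R \<Otimes>\<^sub>M MY) (x, y)) = \<kappa>' x \<bind> (\<lambda>y. return (R \<Otimes>\<^sub>M MY) (x, y))"
    using assms(3) by eventually_elim simp
qed (rule assms(1,2))+

lemma nn_integral_joint_law:
  assumes \<kappa>: "\<kappa> \<in> measurable R (prob_algebra MY)"
    and f: "f \<in> borel_measurable (R \<Otimes>\<^sub>M MY)"
  shows "(\<integral>\<^sup>+z. f z \<partial>joint_law R MY \<kappa>) = (\<integral>\<^sup>+x. \<integral>\<^sup>+y. f (x, y) \<partial>\<kappa> x \<partial>R)"
  unfolding joint_law_def nn_integral_bind[OF f measurable_joint_law_kernel[OF \<kappa>]]
proof (rule nn_integral_cong)
  fix x assume x: "x \<in> space R"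
  have sets: "sets (\<kappa> x) = sets MY"
    using measurable_space[OF \<kappa> x] by (simp add: space_prob_algebra)
  have "(\<lambda>y. return (R \<Otimes>\<^sub>M MY) (x, y)) \<in> measurable (\<kappa> x) (subprob_algebra (R \<Otimes>\<^sub>M MY))"
    using measurable_compose[OF measurable_Pair1'[OF x] return_measurable]
    by (simp add: measurable_cong_sets[OF sets refl])
  then have "(\<integral>\<^sup>+z. f z \<partial>(\<kappa> x \<bind> (\<lambda>y. return (R \<Otimes>\<^sub>M MY) (x, y))))
      = (\<integral>\<^sup>+y. \<integral>\<^sup>+z. f z \<partial>return (R \<Otimes>\<^sub>M MY) (x, y) \<partial>\<kappa> x)"
    using f by (intro nn_integral_bind)
  also have "\<dots> = (\<integral>\<^sup>+y. f (x, y) \<partial>\<kappa> x)"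
    using x f by (intro nn_integral_cong nn_integral_return)
      (auto simp: space_pair_measure sets_eq_imp_space_eq[OF sets])
  finally show "(\<integral>\<^sup>+z. f z \<partial>(\<kappa> x \<bind> (\<lambda>y. return (R \<Otimes>\<^sub>M MY) (x, y)))) = (\<integral>\<^sup>+y. f (x, y) \<partial>\<kappa> x)" .
qed

text \<open>The nonnegative formula is applied to the positive and the negative part. Integrability
  of every slice keeps both inner integrals finite at every point, so their difference is the slice
  integral.\<close>

lemma
  fixes f :: "'a \<times> 'b \<Rightarrow> real"
  assumes R: "prob_space R"
    and \<kappa>: "\<kappa> \<in> measurable R (prob_algebra MY)"
    and f: "integrable (joint_law R MY \<kappa>) f"
    and slices: "\<And>x. x \<in> space R \<Longrightarrow> integrable (\<kappa> x) (\<lambda>y. f (x, y))"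
  shows integrable_joint_law_slices: "integrable R (\<lambda>x. \<integral>y. f (x, y) \<partial>\<kappa> x)"
    and integral_joint_law: "(\<integral>z. f z \<partial>joint_law R MY \<kappa>) = (\<integral>x. \<integral>y. f (x, y) \<partial>\<kappa> x \<partial>R)"
proof -
  \<comment> \<open>\<open>ennreal\<close> sends negative reals to 0, so
    \<open>ennreal (g z)\<close> is the positive part of \<open>g\<close>; taking \<open>g\<close>
    to be \<open>f\<close> and then \<open>- f\<close> yields both parts.\<close>
  have half: "integrable R (\<lambda>x. enn2real (\<integral>\<^sup>+y. ennreal (g (x, y)) \<partial>\<kappa> x)) \<and>
      (\<integral>x. enn2real (\<integral>\<^sup>+y. ennreal (g (x, y)) \<partial>\<kappa> x) \<partial>R) = enn2real (\<integral>\<^sup>+z. ennreal (g z) \<partial>joint_law R MY \<kappa>)"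
    if g: "integrable (joint_law R MY \<kappa>) g" "\<And>x. x \<in> space R \<Longrightarrow> integrable (\<kappa> x) (\<lambda>y. g (x, y))"
    for g :: "'a \<times> 'b \<Rightarrow> real"
  proof -
    let ?u = "\<lambda>x. \<integral>\<^sup>+y. ennreal (g (x, y)) \<partial>\<kappa> x"
    have "g \<in> borel_measurable (R \<Otimes>\<^sub>M MY)"
      using g(1) by (simp add: measurable_cong_sets[OF sets_joint_law[OF R \<kappa>] refl, symmetric])
    then have g_meas: "(\<lambda>z. ennreal (g z)) \<in> borel_measurable (R \<Otimes>\<^sub>M MY)" by simp
    have u_meas: "?u \<in> borel_measurable R"
      using g_meas measurable_prob_algebraD[OF \<kappa>]
      by (intro nn_integral_measurable_subprob_algebra2[where N=MY]) (auto simp: case_prod_unfold)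
    have u_fin: "ennreal (enn2real (?u x)) = ?u x" if "x \<in> space R" for x
      using g(2)[OF that] by (simp add: real_integrable_def less_top)
    have "(\<integral>\<^sup>+x. ennreal (enn2real (?u x)) \<partial>R) = (\<integral>\<^sup>+x. ?u x \<partial>R)"
      by (intro nn_integral_cong u_fin)
    also have "\<dots> = (\<integral>\<^sup>+z. ennreal (g z) \<partial>joint_law R MY \<kappa>)"
      using nn_integral_joint_law[OF \<kappa> g_meas] by simp
    finally have eq: "(\<integral>\<^sup>+x. ennreal (enn2real (?u x)) \<partial>R) = (\<integral>\<^sup>+z. ennreal (g z) \<partial>joint_law R MY \<kappa>)" .
    moreover have "(\<integral>\<^sup>+z. ennreal (g z) \<partial>joint_law R MY \<kappa>) < \<infinity>"
      using g(1) by (simp add: real_integrable_def less_top)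
    ultimately have "integrable R (\<lambda>x. enn2real (?u x))"
      using u_meas by (intro integrableI_nonneg) auto
    with eq show ?thesis
      using u_meas by (simp add: integral_eq_nn_integral)
  qed
  have "integrable (joint_law R MY \<kappa>) (\<lambda>z. - f z)" using f by simp
  note pos = half[OF f slices] and neg = half[OF this Bochner_Integration.integrable_minus[OF slices]]
  have split: "(\<integral>y. f (x, y) \<partial>\<kappa> x) =
      enn2real (\<integral>\<^sup>+y. ennreal (f (x, y)) \<partial>\<kappa> x) - enn2real (\<integral>\<^sup>+y. ennreal (- f (x, y)) \<partial>\<kappa> x)"
    if "x \<in> space R" for x
    using real_lebesgue_integral_def[OF slices[OF that]] by simp
  have "integrable R (\<lambda>x. enn2real (\<integral>\<^sup>+y. ennreal (f (x, y)) \<partial>\<kappa> x) - enn2real (\<integral>\<^sup>+y. ennreal (- f (x, y)) \<partial>\<kappa> x))"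
    using pos neg by (intro Bochner_Integration.integrable_diff) auto
  then show "integrable R (\<lambda>x. \<integral>y. f (x, y) \<partial>\<kappa> x)"
    by (subst Bochner_Integration.integrable_cong[OF refl split]) auto
  have "(\<integral>x. \<integral>y. f (x, y) \<partial>\<kappa> x \<partial>R) =
      (\<integral>x. enn2real (\<integral>\<^sup>+y. ennreal (f (x, y)) \<partial>\<kappa> x) - enn2real (\<integral>\<^sup>+y. ennreal (- f (x, y)) \<partial>\<kappa> x) \<partial>R)"
    by (intro Bochner_Integration.integral_cong refl split)
  also have "\<dots> = enn2real (\<integral>\<^sup>+z. ennreal (f z) \<partial>joint_law R MY \<kappa>) - enn2real (\<integral>\<^sup>+z. ennreal (- f z) \<partial>joint_law R MY \<kappa>)"
    using pos neg by (subst Bochner_Integration.integral_diff) auto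
  also have "\<dots> = (\<integral>z. f z \<partial>joint_law R MY \<kappa>)"
    using real_lebesgue_integral_def[OF f] by simp
  finally show "(\<integral>z. f z \<partial>joint_law R MY \<kappa>) = (\<integral>x. \<integral>y. f (x, y) \<partial>\<kappa> x \<partial>R)" by simp
qed

section \<open>The joint mean embedding for a single Markov kernel\<close>

locale cond_mean_embedding = bounded_continuous_rkhs R k evk kmax
  for R :: "'x::topological_space measure"
    and k and evk :: "'hk::{real_inner,banach,second_countable_topology} \<Rightarrow> 'x \<Rightarrow> real"
    and kmax +
  fixes MY :: "'y measure"
    and l :: "'y \<Rightarrow> 'y \<Rightarrow> real"
    and evl :: "'hl::{real_inner,banach} \<Rightarrow> 'y \<Rightarrow> real"
    and evkl :: "'hkl::{real_inner,banach} \<Rightarrow> 'x \<times> 'y \<Rightarrow> real"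
    and \<kappa> :: "'x \<Rightarrow> 'y measure"
    and \<mu> :: 'hkl
  assumes rkhs_l: "rkhs (space MY) l evl"
    and rkhs_kl: "rkhs (UNIV \<times> space MY) (tensor_kernel k l) evkl"
    and \<kappa>: "\<kappa> \<in> measurable R (prob_algebra MY)"
    and integrable_evl: "\<And>g x. integrable (\<kappa> x) (evl g)"
    and cond_mean_in_Hk: "\<And>g. \<exists>h. \<forall>x. evk h x = (\<integral>y. evl g y \<partial>\<kappa> x)"
    and \<mu>: "has_weak_expectation (joint_law R MY \<kappa>) (kernel_section evkl) \<mu>"
begin

abbreviation A :: "'hl \<Rightarrow> 'hk" where "A \<equiv> cond_mean_op_adj evk evl \<kappa>"

lemma space_R: "space R = UNIV"
  using sets_eq_imp_space_eq[OF sets_R] by simp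

lemma sets_\<kappa>: "sets (\<kappa> x) = sets MY"
  using measurable_space[OF \<kappa>, of x] by (simp add: space_prob_algebra space_R)

text \<open>The definite description in \<open>cond_mean_op_adj\<close> is well defined: a suitable
  element exists by assumption, and elements of the RKHS are determined by their values.\<close>

lemma evk_A: "evk (A g) x = (\<integral>y. evl g y \<partial>\<kappa> x)"
proof -
  obtain h where h: "\<forall>x. evk h x = (\<integral>y. evl g y \<partial>\<kappa> x)"
    using cond_mean_in_Hk by blast
  have "A g = h"
    unfolding cond_mean_op_adj_def
  proof (rule the_equality[of _ h])
    fix h' assume "\<forall>x. evk h' x = (\<integral>y. evl g y \<partial>\<kappa> x)"
    then show "h' = h" using rkhs_k h by (simp add: rkhs_def)
  qed (rule h)
  then show ?thesis using h by simp
qed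

text \<open>Each evaluation of \<open>A g\<close> is an integral against \<open>\<kappa> x\<close>,
  bounded in \<open>g\<close> by the first Baire argument; the second one passes from evaluations to
  \<open>A\<close> itself.\<close>

lemma bounded_linear_A: "bounded_linear A"
  using rkhs_k
proof (rule bounded_linear_if_pointwise)
  fix x
  have "rkhs (space (\<kappa> x)) l evl"
    using rkhs_l by (simp add: sets_eq_imp_space_eq[OF sets_\<kappa>])
  then show "bounded_linear (\<lambda>g. evk (A g) x)"
    unfolding evk_A using integrable_evl by (rule integral_functional_bounded)
qed

text \<open>Integrating over \<open>y\<close> first turns the slice of \<open>h\<close> at
  \<open>x\<close> into the value of \<open>A (G x)\<close> at \<open>x\<close>. The two uses are
  sections of the tensor kernel and the difference of the two embeddings.\<close>

lemma
  assumes G: "\<And>x y. y \<in> space MY \<Longrightarrow> evkl h (x, y) = evl (G x) y"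
  shows integrable_inner_\<mu>: "integrable R (\<lambda>x. evk (A (G x)) x)"
    and inner_\<mu>: "h \<bullet> \<mu> = (\<integral>x. evk (A (G x)) x \<partial>R)"
proof -
  note R = prob_space_axioms
  have space_J: "space (joint_law R MY \<kappa>) = UNIV \<times> space MY"
    using sets_eq_imp_space_eq[OF sets_joint_law[OF R \<kappa>]] by (simp add: space_pair_measure space_R)
  \<comment> \<open>The reproducing property is available only on
    \<open>UNIV \<times> space MY\<close>, which is the space of the joint law.\<close>
  have cong: "h \<bullet> kernel_section evkl z = evkl h z" if "z \<in> space (joint_law R MY \<kappa>)" for z
    using inner_kernel_section[OF rkhs_kl] that by (simp add: space_J)
  have "integrable (joint_law R MY \<kappa>) (\<lambda>z. h \<bullet> kernel_section evkl z)"
    and h\<mu>: "h \<bullet> \<mu> = (\<integral>z. h \<bullet> kernel_section evkl z \<partial>joint_law R MY \<kappa>)"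
    using \<mu> by (auto simp: has_weak_expectation_def)
  then have int: "integrable (joint_law R MY \<kappa>) (evkl h)"
    by (subst (asm) Bochner_Integration.integrable_cong[OF refl cong]) auto
  have G': "evkl h (x, y) = evl (G x) y" if "y \<in> space (\<kappa> x)" for x y
    using G that by (simp add: sets_eq_imp_space_eq[OF sets_\<kappa>])
  have slices: "integrable (\<kappa> x) (\<lambda>y. evkl h (x, y))" for x
    using integrable_evl by (subst Bochner_Integration.integrable_cong[OF refl G']) auto
  have int_slice: "(\<integral>y. evkl h (x, y) \<partial>\<kappa> x) = evk (A (G x)) x" for x
    unfolding evk_A by (intro Bochner_Integration.integral_cong refl G')
  show "integrable R (\<lambda>x. evk (A (G x)) x)"
    using integrable_joint_law_slices[OF R \<kappa> int slices] by (simp add: int_slice)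
  have "h \<bullet> \<mu> = (\<integral>z. evkl h z \<partial>joint_law R MY \<kappa>)"
    unfolding h\<mu> by (intro Bochner_Integration.integral_cong refl cong)
  then show "h \<bullet> \<mu> = (\<integral>x. evk (A (G x)) x \<partial>R)"
    using integral_joint_law[OF R \<kappa> int slices] by (simp add: int_slice)
qed

text \<open>The slice at \<open>x'\<close> of the section at \<open>(x, y)\<close> is a multiple of
  the section of \<open>l\<close> at \<open>y\<close>. Its factor \<open>k x' x\<close> is the value
  of \<open>\<phi> x\<close> at \<open>x'\<close>, so linearity of \<open>A\<close> and
  \<open>inner_C\<close> finish.\<close>

lemma evkl_\<mu>:
  assumes y: "y \<in> space MY"
  shows "evkl \<mu> (x, y) = \<phi> x \<bullet> C (A (kernel_section evl y))"
proof -
  have z: "(x, y) \<in> UNIV \<times> space MY" using y by simp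
  have lin: "linear (\<lambda>g. evl g y')" if "y' \<in> space MY" for y'
    using rkhs_l that by (auto simp: rkhs_def)
  have "evkl \<mu> (x, y) = kernel_section evkl (x, y) \<bullet> \<mu>"
    using inner_kernel_section[OF rkhs_kl z, of \<mu>] by (simp only: inner_commute)
  also have "\<dots> = (\<integral>x'. evk (A (k x' x *\<^sub>R kernel_section evl y)) x' \<partial>R)"
  proof (rule inner_\<mu>)
    fix x' y' assume y': "y' \<in> space MY"
    then show "evkl (kernel_section evkl (x, y)) (x', y') = evl (k x' x *\<^sub>R kernel_section evl y) y'"
      using kernel_section_apply[OF rkhs_kl z, of "(x', y')"] kernel_section_apply[OF rkhs_l y y']
      by (simp add: tensor_kernel_def linear_scale[OF lin])
  qed
  also have "\<dots> = (\<integral>x'. evk (\<phi> x) x' * evk (A (kernel_section evl y)) x' \<partial>R)"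
    by (simp add: linear_scale[OF bounded_linear.linear[OF bounded_linear_A]] evk_scaleR
        kernel_section_apply[OF rkhs_k])
  finally show ?thesis by (simp add: inner_C)
qed

end

section \<open>The squared discrepancy as a trace\<close>

theorem theorem3p3:
  fixes P Q :: "'o measure"
    and X :: "'o \<Rightarrow> 'x::topological_space"
    and Y Z :: "'o \<Rightarrow> 'y"
    and MY :: "'y measure"
    and PX QX R :: "'x measure"
    and \<kappa>P \<kappa>Q \<kappa>P' \<kappa>Q' :: "'x \<Rightarrow> 'y measure"
    and \<alpha> kmax \<gamma> :: real
    and k :: "'x \<Rightarrow> 'x \<Rightarrow> real"
    and l :: "'y \<Rightarrow> 'y \<Rightarrow> real"
    and evk :: "'hk::{real_inner,banach,second_countable_topology} \<Rightarrow> 'x \<Rightarrow> real"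
    and evl :: "'hl::{real_inner,banach} \<Rightarrow> 'y \<Rightarrow> real"
    and evkl :: "'hkl::{real_inner,banach} \<Rightarrow> 'x \<times> 'y \<Rightarrow> real"
    and CXX :: "'hk \<Rightarrow> 'hk"
    and \<Delta> :: "'hk \<Rightarrow> 'hl"
  assumes P: "prob_space P" and Q: "prob_space Q" and PQ: "sets P = sets Q"
    and X: "X \<in> measurable P borel"
    and Y: "Y \<in> measurable P MY"
    and Z: "Z \<in> measurable P MY"
    and PX_def: "PX = distr P borel X"
    and QX_def: "QX = distr Q borel X"
    and full_support: "full_support PX" "full_support QX"
    and mutually_ac: "absolutely_continuous PX QX" "absolutely_continuous QX PX"
    and \<alpha>: "0 \<le> \<alpha>" "\<alpha> \<le> 1"
    and R_def: "R = mixture \<alpha> PX QX"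
    and cond_distr_P: "regular_cond_distr P borel MY X Y \<kappa>P"
    and cond_distr_Q: "regular_cond_distr Q borel MY X Z \<kappa>Q"
    and k_pd: "pos_def_kernel UNIV k"
    and k_meas: "(\<lambda>(x, x'). k x x') \<in> borel_measurable (borel \<Otimes>\<^sub>M borel)"
    and k_cont: "continuous_on UNIV (\<lambda>(x, x'). k x x')"
    and k_bdd: "\<And>x. k x x \<le> kmax"
    and l_pd: "pos_def_kernel (space MY) l"
    and l_meas: "(\<lambda>(y, y'). l y y') \<in> borel_measurable (MY \<Otimes>\<^sub>M MY)"
    and Hk: "rkhs UNIV k evk"
    and Hl: "rkhs (space MY) l evl"
    and Hkl: "rkhs (UNIV \<times> space MY) (tensor_kernel k l) evkl"
    and mean_embeddings_exist:
      "joint_mean_embedding_exists evkl R MY \<kappa>P"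
      "joint_mean_embedding_exists evkl R MY \<kappa>Q"
    and CXX_def: "CXX = covariance_op R evk"
    and \<gamma>: "\<gamma> \<ge> 1 / 2"
    and representative_P: "markov_kernel borel MY \<kappa>P'" "AE x in PX. \<kappa>P' x = \<kappa>P x"
    and representative_Q: "markov_kernel borel MY \<kappa>Q'" "AE x in QX. \<kappa>Q' x = \<kappa>Q x"
    and integrable_P: "\<And>g x. integrable (\<kappa>P' x) (evl g)"
    and integrable_Q: "\<And>g x. integrable (\<kappa>Q' x) (evl g)"
    and range_P: "\<And>g. \<exists>h \<in> range (op_powr CXX \<gamma>). \<forall>x. evk h x = (\<integral>y. evl g y \<partial>\<kappa>P' x)"
    and range_Q: "\<And>g. \<exists>h \<in> range (op_powr CXX \<gamma>). \<forall>x. evk h x = (\<integral>y. evl g y \<partial>\<kappa>Q' x)"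
    and \<Delta>_def: "\<Delta> = (\<lambda>f. cond_mean_op evk evl \<kappa>P' f - cond_mean_op evk evl \<kappa>Q' f)"
  shows "trace_class (adjoint \<Delta> \<circ> \<Delta> \<circ> CXX ^^ 2) \<and>
         (CMMD2 evkl R MY \<kappa>P \<kappa>Q)\<^sup>2 = op_trace (adjoint \<Delta> \<circ> \<Delta> \<circ> CXX ^^ 2)"
proof -
  let ?\<phi> = "kernel_section evk"
  interpret P: prob_space P by fact
  interpret Q: prob_space Q by fact
  have "X \<in> measurable Q borel"
    using X by (simp add: measurable_cong_sets[OF PQ refl])
  then have prob_PQ: "prob_space PX" "prob_space QX"
    using X unfolding PX_def QX_def by (auto intro: P.prob_space_distr Q.prob_space_distr)
  have sets [simp]: "sets PX = sets borel" "sets QX = sets borel" and sets_R: "sets R = sets borel"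
    by (simp_all add: PX_def QX_def R_def)
  have emeasure_R: "emeasure R S = ennreal \<alpha> * emeasure PX S + ennreal (1 - \<alpha>) * emeasure QX S"
    if "S \<in> sets borel" for S
    using that unfolding R_def by (intro emeasure_mixture) auto
  have prob_R: "prob_space R"
  proof
    have "emeasure R UNIV = ennreal \<alpha> + ennreal (1 - \<alpha>)"
      using prob_space.emeasure_space_1[OF prob_PQ(1)] prob_space.emeasure_space_1[OF prob_PQ(2)]
      by (simp add: emeasure_R PX_def QX_def)
    also have "\<dots> = 1" using \<alpha> by (simp flip: ennreal_plus)
    finally show "emeasure R (space R) = 1"
      using sets_eq_imp_space_eq[OF sets_R] by simp
  qed
  \<comment> \<open>A null set of one marginal is null for the other, hence for the mixture. Thus
    equality of kernels almost everywhere under \<open>PX\<close> or \<open>QX\<close> also holds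
    under \<open>R\<close>.\<close>
  have ac_R: "absolutely_continuous PX R" "absolutely_continuous QX R"
    using mutually_ac by (auto simp: absolutely_continuous_def null_sets_def sets_R emeasure_R)

  have measurable_kernel: "\<kappa> \<in> measurable R (prob_algebra MY)" if "markov_kernel borel MY \<kappa>" for \<kappa>
    using that by (simp add: markov_kernel_def measurable_cong_sets[OF sets_R refl])
  have joint_law_P: "joint_law R MY \<kappa>P = joint_law R MY \<kappa>P'"
    using cond_distr_P representative_P(1) absolutely_continuous_AE[OF _ ac_R(1) representative_P(2)]
    by (intro joint_law_cong_AE measurable_kernel)
      (auto simp: regular_cond_distr_def sets_R elim: eventually_mono)
  have joint_law_Q: "joint_law R MY \<kappa>Q = joint_law R MY \<kappa>Q'"
    using cond_distr_Q representative_Q(1) absolutely_continuous_AE[OF _ ac_R(2) representative_Q(2)]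
    by (intro joint_law_cong_AE measurable_kernel)
      (auto simp: regular_cond_distr_def sets_R elim: eventually_mono)
  obtain \<mu>P where \<mu>P: "has_weak_expectation (joint_law R MY \<kappa>P') (kernel_section evkl) \<mu>P"
    using mean_embeddings_exist(1) by (auto simp: joint_mean_embedding_exists_def joint_law_P)
  obtain \<mu>Q where \<mu>Q: "has_weak_expectation (joint_law R MY \<kappa>Q') (kernel_section evkl) \<mu>Q"
    using mean_embeddings_exist(2) by (auto simp: joint_mean_embedding_exists_def joint_law_Q)
  have CMMD2: "CMMD2 evkl R MY \<kappa>P \<kappa>Q = norm (\<mu>P - \<mu>Q)"
    by (simp add: CMMD2_def joint_mean_embedding_def joint_law_P joint_law_Q
        weak_expectation_eqI[OF \<mu>P] weak_expectation_eqI[OF \<mu>Q])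

  interpret bounded_continuous_rkhs R k evk kmax
    using prob_R Hk k_cont k_bdd sets_R
    by (simp add: bounded_continuous_rkhs_def bounded_continuous_rkhs_axioms_def)
  interpret KP: cond_mean_embedding R k evk kmax MY l evl evkl \<kappa>P' \<mu>P
    using Hl Hkl measurable_kernel[OF representative_P(1)] integrable_P range_P \<mu>P
    by unfold_locales blast+
  interpret KQ: cond_mean_embedding R k evk kmax MY l evl evkl \<kappa>Q' \<mu>Q
    using Hl Hkl measurable_kernel[OF representative_Q(1)] integrable_Q range_Q \<mu>Q
    by unfold_locales blast+

  \<comment> \<open>\<open>\<Delta>\<close> is given through adjoints, so boundedness is obtained
    first for \<open>B\<close> and then carried over to \<open>\<Delta>\<close> by taking
    adjoints.\<close>
  define B where "B g = KP.A g - KQ.A g" for g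
  have bounded_B: "bounded_linear B"
    unfolding B_def using KP.bounded_linear_A KQ.bounded_linear_A by (rule bounded_linear_sub)
  have inner_\<Delta>: "B g \<bullet> f = g \<bullet> \<Delta> f" for f g
    by (simp add: B_def \<Delta>_def cond_mean_op_def inner_diff_left inner_diff_right
        inner_adjoint[OF KP.bounded_linear_A] inner_adjoint[OF KQ.bounded_linear_A])
  have adjoint_B: "adjoint B = \<Delta>"
    using inner_\<Delta> by (intro adjoint_unique) auto
  have adjoint_\<Delta>: "adjoint \<Delta> = B"
    using inner_\<Delta> by (intro adjoint_unique) (metis inner_commute)
  have bounded_\<Delta>: "bounded_linear \<Delta>"
    using bounded_linear_adjoint[OF bounded_B] by (simp add: adjoint_B)
  \<comment> \<open>One factor of the square of \<open>C\<close> goes into \<open>S\<close>, which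
    makes \<open>S\<close> Hilbert-Schmidt; the other stays outside, as
    \<open>trace_compose_C\<close> requires.\<close>
  define S where "S f = B (\<Delta> (C f))" for f
  have bounded_S: "bounded_linear S"
    unfolding S_def
    by (intro bounded_linear_compose[OF bounded_B] bounded_linear_compose[OF bounded_\<Delta>] bounded_linear_C)
  have op_eq: "adjoint \<Delta> \<circ> \<Delta> \<circ> CXX ^^ 2 = S \<circ> C"
    by (simp add: adjoint_\<Delta> CXX_def S_def fun_eq_iff numeral_2_eq_2)

  have "hilbert_schmidt S" and "hilbert_schmidt C"
  proof -
    show "hilbert_schmidt C"
      using hilbert_schmidt_compose_C[OF bounded_linear_ident] by (simp add: o_def)
    have "S = (\<lambda>f. B (\<Delta> f)) \<circ> C" by (simp add: S_def fun_eq_iff)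
    then show "hilbert_schmidt S"
      using hilbert_schmidt_compose_C[OF bounded_linear_compose[OF bounded_B bounded_\<Delta>]] by simp
  qed
  then have trace_class: "trace_class (S \<circ> C)"
    unfolding trace_class_def by blast

  let ?D = "\<mu>P - \<mu>Q"
  \<comment> \<open>This exhibits every slice of \<open>?D\<close> as an element of the RKHS of
    \<open>l\<close>, which is what \<open>inner_\<mu>\<close> asks for.\<close>
  have evkl_D: "evkl ?D (x, y) = evl (\<Delta> (C (?\<phi> x))) y" if y: "y \<in> space MY" for x y
  proof -
    have "linear (\<lambda>h. evkl h (x, y))"
      using Hkl y by (auto simp: rkhs_def)
    then have "evkl ?D (x, y) = evkl \<mu>P (x, y) - evkl \<mu>Q (x, y)"
      by (rule linear_diff)
    also have "\<dots> = ?\<phi> x \<bullet> C (B (kernel_section evl y))"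
      using linear_diff[OF bounded_linear.linear[OF bounded_linear_C]]
      by (simp add: KP.evkl_\<mu>[OF y] KQ.evkl_\<mu>[OF y] B_def inner_diff_right)
    also have "\<dots> = B (kernel_section evl y) \<bullet> C (?\<phi> x)"
      by (subst inner_C_commute) (rule inner_commute)
    also have "\<dots> = \<Delta> (C (?\<phi> x)) \<bullet> kernel_section evl y"
      unfolding inner_\<Delta> by (rule inner_commute)
    also have "\<dots> = evl (\<Delta> (C (?\<phi> x))) y"
      using Hl y by (rule inner_kernel_section)
    finally show ?thesis .
  qed
  \<comment> \<open>Only one factor of the squared norm is split; each half is then an integral
    against its own joint law with the same slices.\<close>
  have "(CMMD2 evkl R MY \<kappa>P \<kappa>Q)\<^sup>2 = ?D \<bullet> \<mu>P - ?D \<bullet> \<mu>Q"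
    by (simp add: CMMD2 power2_norm_eq_inner inner_diff_right)
  also have "\<dots> = (\<integral>x. evk (KP.A (\<Delta> (C (?\<phi> x)))) x - evk (KQ.A (\<Delta> (C (?\<phi> x)))) x \<partial>R)"
    using KP.inner_\<mu>[OF evkl_D] KQ.inner_\<mu>[OF evkl_D]
      KP.integrable_inner_\<mu>[OF evkl_D] KQ.integrable_inner_\<mu>[OF evkl_D] by simp
  also have "\<dots> = (\<integral>x. S (?\<phi> x) \<bullet> ?\<phi> x \<partial>R)"
    by (simp add: S_def B_def inner_\<phi> evk_diff)
  also have "\<dots> = op_trace (S \<circ> C)"
    using trace_compose_C[OF bounded_S someI_ex[OF orthonormal_basis_exists]]
    by (simp add: op_trace_def)
  finally show ?thesis
    using trace_class by (simp only: op_eq)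
qed

end
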